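(* Let $H\supseteq\mathbb{R}$ be a Liouville closed Hardy field and let $\phi\in\mathcal{C}$ satisfy $\phi>_{\mathrm{e}}H$. Then there exists $y\in\mathcal{C}^{\infty}$ with $y>_{\mathrm{e}}\phi$ that generates a Hardy field $H\langle y\rangle$ over $H$.
   Context: $\mathcal{C}$ is the ring of germs at $+\infty$ of continuous functions $[a,+\infty)\to\mathbb{R}$ ($a\in\mathbb{R}$), $\mathcal{C}^\infty$ its subring of germs of $C^\infty$ functions, and $\mathcal{C}^{<\infty}$ the differential ring of germs that are $n$ times continuously differentiable for every $n$. For $g,h\in\mathcal{C}$, $g<_{\mathrm{e}}h$ means $g(t)<h(t)$ for all sufficiently large $t$; $\phi>_{\mathrm{e}}H$ means $h<_{\mathrm{e}}\phi$ for all $h\in H$. A Hardy field is a subfield of the ring of germs at $+\infty$ of real differentiable functions that is closed under differentiation. A Hardy field $H\supseteq\mathbb{R}$ is Liouville closed if it is real closed and for every $f\in H$ it contains $\exp(f)$ and some germ $g$ with $g'=f$. "$y$ generates a Hardy field $H\langle y\rangle$ over $H$" means that the subfield $H(y,y',y'',\dots)$ of germs generated over $H$ by $y$ and all its derivatives is a Hardy field. *)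

theory Defs
  imports "HOL-Analysis.Analysis" "HOL-Computational_Algebra.Polynomial"
begin

section \<open>Germs at $+\infty$ of real functions\<close>

quotient_type germ = "real \<Rightarrow> real" / "\<lambda>f g. eventually (\<lambda>t. f t = g t) at_top"
proof (rule equivpI)
  show "reflp (\<lambda>f g :: real \<Rightarrow> real. eventually (\<lambda>t. f t = g t) at_top)"
    by (rule reflpI) simp
  show "symp (\<lambda>f g :: real \<Rightarrow> real. eventually (\<lambda>t. f t = g t) at_top)"
    by (rule sympI) (auto elim: eventually_mono)
  show "transp (\<lambda>f g :: real \<Rightarrow> real. eventually (\<lambda>t. f t = g t) at_top)"
    by (rule transpI) (auto elim: eventually_elim2)
qed

lift_definition germ_of :: "(real \<Rightarrow> real) \<Rightarrow> germ" is "\<lambda>f. f" .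

instantiation germ :: "{comm_ring_1, real_algebra_1}"
begin

lift_definition zero_germ :: germ is "\<lambda>t. 0" .
lift_definition one_germ :: germ is "\<lambda>t. 1" .
lift_definition plus_germ :: "germ \<Rightarrow> germ \<Rightarrow> germ" is "\<lambda>f g t. f t + g t"
  by (auto elim: eventually_elim2)
lift_definition times_germ :: "germ \<Rightarrow> germ \<Rightarrow> germ" is "\<lambda>f g t. f t * g t"
  by (auto elim: eventually_elim2)
lift_definition uminus_germ :: "germ \<Rightarrow> germ" is "\<lambda>f t. - f t"
  by (auto elim: eventually_mono)
lift_definition minus_germ :: "germ \<Rightarrow> germ \<Rightarrow> germ" is "\<lambda>f g t. f t - g t"
  by (auto elim: eventually_elim2)
lift_definition scaleR_germ :: "real \<Rightarrow> germ \<Rightarrow> germ" is "\<lambda>c f t. c * f t"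
  by (auto elim: eventually_mono)

instance
  by standard (transfer; simp add: algebra_simps eventually_False)+

end

lift_definition germ_less :: "germ \<Rightarrow> germ \<Rightarrow> bool"  (infix \<open><\<^sub>e\<close> 50)
  is "\<lambda>f g. eventually (\<lambda>t. f t < g t) at_top"
proof -
  fix f f' g g' :: "real \<Rightarrow> real"
  assume "eventually (\<lambda>t. f t = f' t) at_top" "eventually (\<lambda>t. g t = g' t) at_top"
  then have "eventually (\<lambda>t. f t < g t \<longleftrightarrow> f' t < g' t) at_top"
    by eventually_elim simp
  then show "eventually (\<lambda>t. f t < g t) at_top = eventually (\<lambda>t. f' t < g' t) at_top"
    by (rule eventually_cong) simp
qed

lift_definition germ_exp :: "germ \<Rightarrow> germ" is "\<lambda>f t. exp (f t)"
  by (auto elim: eventually_mono)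

text \<open>
  The value is meaningful only for germs of eventually differentiable functions,
  since \<^const>\<open>deriv\<close> is arbitrary where the function is not differentiable.
\<close>
lift_definition germ_deriv :: "germ \<Rightarrow> germ" is "deriv"
proof -
  fix f g :: "real \<Rightarrow> real"
  assume "eventually (\<lambda>t. f t = g t) at_top"
  then obtain a where a: "\<And>t. t \<ge> a \<Longrightarrow> f t = g t"
    by (auto simp: eventually_at_top_linorder)
  have "deriv f t = deriv g t" if "t > a" for t
  proof (rule deriv_cong_ev)
    have "eventually (\<lambda>s. s \<in> {a<..}) (nhds t)"
      using that by (intro eventually_nhds_in_open) auto
    then show "eventually (\<lambda>s. f s = g s) (nhds t)"
      by eventually_elim (simp add: a)
  qed simp
  then show "eventually (\<lambda>t. deriv f t = deriv g t) at_top"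
    by (intro eventually_mono[OF eventually_gt_at_top[of a]]) auto
qed

definition continuous_germs :: "germ set" where
  "continuous_germs = {germ_of f |f. \<exists>a. continuous_on {a..} f}"

definition differentiable_germs :: "germ set" where
  "differentiable_germs = {germ_of f |f. \<exists>a. f differentiable_on {a..}}"

text \<open>
  One \<open>a\<close> serves all orders of differentiation, as opposed to germs that are \<open>n\<close> times
  continuously differentiable for every \<open>n\<close>. The ray is open because \<^const>\<open>deriv\<close> is
  two-sided; this yields the same germs as smoothness on a closed ray.
\<close>
definition smooth_germs :: "germ set" where
  "smooth_germs = {germ_of f |f. \<exists>a. \<forall>n. (deriv ^^ n) f differentiable_on {a<..}}"


section \<open>Hardy fields\<close>

definition is_subfield :: "'a::comm_ring_1 set \<Rightarrow> bool" where
  "is_subfield K \<longleftrightarrow> 1 \<in> K \<and> (\<forall>x\<in>K. \<forall>y\<in>K. x - y \<in> K \<and> x * y \<in> K) \<and>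
     (\<forall>x\<in>K. x \<noteq> 0 \<longrightarrow> (\<exists>y\<in>K. x * y = 1))"

definition hardy_field :: "germ set \<Rightarrow> bool" where
  "hardy_field H \<longleftrightarrow> is_subfield H \<and> H \<subseteq> differentiable_germs \<and> (\<forall>f\<in>H. germ_deriv f \<in> H)"

text \<open>
  A Hardy field is an ordered field under \<open><\<^sub>e\<close>; the following is real closedness of an
  ordered field: positive elements are squares, and polynomials of odd degree have zeros.
\<close>
definition real_closed :: "germ set \<Rightarrow> bool" where
  "real_closed H \<longleftrightarrow> (\<forall>f\<in>H. 0 <\<^sub>e f \<longrightarrow> (\<exists>g\<in>H. f = g\<^sup>2)) \<and>
     (\<forall>p :: germ poly. set (coeffs p) \<subseteq> H \<and> odd (degree p) \<longrightarrow> (\<exists>z\<in>H. poly p z = 0))"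

definition liouville_closed :: "germ set \<Rightarrow> bool" where
  "liouville_closed H \<longleftrightarrow> real_closed H \<and>
     (\<forall>f\<in>H. germ_exp f \<in> H \<and> (\<exists>g\<in>H. germ_deriv g = f))"

text \<open>
  If no subfield of the ring of germs contains \<open>H\<close> and all derivatives of \<open>y\<close>, then the
  hull is the whole ring of germs, which is not a field, let alone a Hardy field; otherwise it is
  the least such subfield.
\<close>
definition generated_diff_field :: "germ set \<Rightarrow> germ \<Rightarrow> germ set" where
  "generated_diff_field H y = is_subfield hull (H \<union> range (\<lambda>n. (germ_deriv ^^ n) y))"

definition generates_hardy_field :: "germ \<Rightarrow> germ set \<Rightarrow> bool" where
  "generates_hardy_field y H \<longleftrightarrow> hardy_field (generated_diff_field H y)"

end

theory Submission
  imports Defs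
begin

text \<open>
  Let \<open>y\<^sub>0, y\<^sub>1, \<dots>\<close> be germs such that \<open>y\<^sub>n\<^sub>+\<^sub>1\<close> is the logarithmic derivative of \<open>y\<^sub>n\<close>, each \<open>y\<^sub>n\<close>
  exceeds \<open>H\<close>, and \<open>y\<^sub>n\<close> exceeds all powers of \<open>y\<^sub>n\<^sub>+\<^sub>1\<close>. Then each \<open>y\<^sub>n\<close> exceeds the field generated over
  \<open>H\<close> by finitely many of the later ones, so that \<open>H(y\<^sub>0, y\<^sub>1, \<dots>)\<close> is a field; it is closed under
  differentiation, and hence a Hardy field.

  Such germs are obtained from \<open>y\<^sub>n(t) = b\<^sub>n(t) exp (\<integral>\<^sub>0\<^sup>t y\<^sub>n\<^sub>+\<^sub>1)\<close>, where \<open>b\<^sub>n\<close> is a smooth step from \<open>0\<close> up to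
  time \<open>n\<close> to a constant \<open>c\<^sub>n\<close> from time \<open>n + 1\<close> on. The steps are chosen such that
  \<open>y\<^sub>n\<^sub>+\<^sub>1 \<le> y\<^sub>n / 2\<close>, which is possible with \<open>c\<^sub>n\<close> arbitrarily large; then \<open>y\<^sub>0 \<ge> c\<^sub>n\<close> from time \<open>n + 1\<close> on
  gives \<open>y\<^sub>0 > \<phi>\<close>. Since the \<open>y\<^sub>n\<close> are nondecreasing, \<open>y\<^sub>n > H\<close> carries over to \<open>y\<^sub>n\<^sub>+\<^sub>1\<close>.
\<close>

subsection \<open>Germs\<close>

lemma germ_cases: obtains f where "x = germ_of f"
proof -
  have "\<exists>f. x = germ_of f"
    by (induction x rule: germ.abs_induct) (auto simp: germ_of.abs_eq)
  then show ?thesis using that by blast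
qed

lemma germ_of_eq_iff: "germ_of f = germ_of g \<longleftrightarrow> eventually (\<lambda>t. f t = g t) at_top"
  by transfer simp

lemma germ_of_add: "germ_of f + germ_of g = germ_of (\<lambda>t. f t + g t)"
  and germ_of_diff: "germ_of f - germ_of g = germ_of (\<lambda>t. f t - g t)"
  and germ_of_mult: "germ_of f * germ_of g = germ_of (\<lambda>t. f t * g t)"
  and germ_of_minus: "- germ_of f = germ_of (\<lambda>t. - f t)"
  and zero_germ_of: "0 = germ_of (\<lambda>t. 0)"
  and one_germ_of: "1 = germ_of (\<lambda>t. 1)"
  and germ_exp_of: "germ_exp (germ_of f) = germ_of (\<lambda>t. exp (f t))"
  and germ_deriv_of: "germ_deriv (germ_of f) = germ_of (deriv f)"
  by (transfer; simp)+

lemma germ_of_power: "germ_of f ^ n = germ_of (\<lambda>t. f t ^ n)"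
  by (induction n) (simp_all add: one_germ_of germ_of_mult)

lemma of_real_germ: "of_real c = germ_of (\<lambda>t. c)"
  unfolding of_real_def by transfer simp

lemma germ_of_less_iff: "germ_of f <\<^sub>e germ_of g \<longleftrightarrow> eventually (\<lambda>t. f t < g t) at_top"
  by transfer simp

text \<open>Total because \<open>inverse 0 = 0\<close>. The equation
  \<open>x * germ_inv x = 1\<close> says that \<open>x\<close> is eventually nonzero, which in this
  ring with zero divisors is stronger than \<open>x \<noteq> 0\<close>.\<close>

lift_definition germ_inv :: "germ \<Rightarrow> germ" is "\<lambda>f t. inverse (f t)"
  by (auto elim: eventually_mono)

lemma germ_inv_of: "germ_inv (germ_of f) = germ_of (\<lambda>t. inverse (f t))"
  by transfer simp

lemma germ_inv_mult: "germ_inv (x * y) = germ_inv x * germ_inv y"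
  by transfer simp

lemma germ_inv_germ_inv: "germ_inv (germ_inv x) = x"
  by transfer simp

lemmas germ_of_simps = germ_of_eq_iff germ_of_add germ_of_diff germ_of_mult germ_of_minus
  zero_germ_of one_germ_of germ_of_power germ_of_less_iff germ_inv_of

lemma germ_less_irrefl: "\<not> x <\<^sub>e x"
  by transfer (simp add: eventually_False)

lemma germ_less_trans: "x <\<^sub>e y \<Longrightarrow> y <\<^sub>e z \<Longrightarrow> x <\<^sub>e z"
  by transfer (auto elim: eventually_elim2)

lemma germ_inv_unique:
  assumes "x * y = 1" shows "y = germ_inv x"
  using assms by transfer (auto elim!: eventually_mono simp: inverse_unique)

lemma subfield_germ_inv:
  assumes "is_subfield K" "x \<in> K" "x \<noteq> 0"
  shows "germ_inv x \<in> K" "x * germ_inv x = 1"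
  using assms germ_inv_unique unfolding is_subfield_def by metis+

lemma is_subfield_germI:
  assumes "1 \<in> K" "\<And>x y. x \<in> K \<Longrightarrow> y \<in> K \<Longrightarrow> x - y \<in> K"
    "\<And>x y. x \<in> K \<Longrightarrow> y \<in> K \<Longrightarrow> x * y \<in> K"
    "\<And>x. x \<in> K \<Longrightarrow> x \<noteq> 0 \<Longrightarrow> germ_inv x \<in> K \<and> x * germ_inv x = 1"
  shows "is_subfield K"
  using assms unfolding is_subfield_def by blast

lemma subfield_closed:
  assumes "is_subfield K"
  shows subfield_one: "1 \<in> K" and subfield_zero: "0 \<in> K"
    and subfield_diff: "x \<in> K \<Longrightarrow> y \<in> K \<Longrightarrow> x - y \<in> K"
    and subfield_mult: "x \<in> K \<Longrightarrow> y \<in> K \<Longrightarrow> x * y \<in> K"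
    and subfield_minus: "x \<in> K \<Longrightarrow> - x \<in> K"
    and subfield_add: "x \<in> K \<Longrightarrow> y \<in> K \<Longrightarrow> x + y \<in> K"
proof -
  show o: "1 \<in> K" and d: "\<And>x y. x \<in> K \<Longrightarrow> y \<in> K \<Longrightarrow> x - y \<in> K"
    and "x \<in> K \<Longrightarrow> y \<in> K \<Longrightarrow> x * y \<in> K"
    using assms by (auto simp: is_subfield_def)
  show z: "0 \<in> K" using d[OF o o] by simp
  show m: "\<And>x. x \<in> K \<Longrightarrow> - x \<in> K" using d[OF z] by simp
  show "x \<in> K \<Longrightarrow> y \<in> K \<Longrightarrow> x + y \<in> K" using d[of x "- y"] m by simp
qed

subsection \<open>Differentiable germs\<close>

lemma germ_of_has_deriv:
  assumes "eventually (\<lambda>t. (f has_real_derivative f' t) (at t)) at_top"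
  shows "germ_of f \<in> differentiable_germs" "germ_deriv (germ_of f) = germ_of f'"
proof -
  obtain a where a: "\<And>t. t \<ge> a \<Longrightarrow> (f has_real_derivative f' t) (at t)"
    using assms by (auto simp: eventually_at_top_linorder)
  then have "f differentiable_on {a..}"
    by (intro differentiable_at_imp_differentiable_on) (auto simp: real_differentiable_def)
  then show "germ_of f \<in> differentiable_germs" unfolding differentiable_germs_def by blast
  show "germ_deriv (germ_of f) = germ_of f'"
    unfolding germ_deriv_of germ_of_eq_iff
    using assms by eventually_elim (rule DERIV_imp_deriv)
qed

lemma differentiable_germ_cases:
  assumes "x \<in> differentiable_germs"
  obtains f a where "x = germ_of f" "continuous_on {a..} f"
    "\<And>t. t > a \<Longrightarrow> (f has_real_derivative deriv f t) (at t)"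
proof -
  obtain f a where f: "x = germ_of f" "f differentiable_on {a..}"
    using assms unfolding differentiable_germs_def by blast
  have "(f has_real_derivative deriv f t) (at t)" if "t > a" for t
  proof -
    have "f differentiable (at t within {a..})"
      using f(2) that by (simp add: differentiable_on_def)
    then have "f differentiable (at t within {a<..})"
      by (rule differentiable_within_subset) auto
    then have "f differentiable (at t)"
      using that by (simp add: at_within_open[of t "{a<..}"])
    then show ?thesis using DERIV_deriv_iff_real_differentiable by blast
  qed
  with f show ?thesis using that differentiable_imp_continuous_on by blast
qed

text \<open>Differentiability is a property of the germ: any two representatives agree on an open
  ray, and \<open>deriv\<close> is local.\<close>

lemma differentiable_germ_of_deriv:
  assumes "germ_of f \<in> differentiable_germs"
  shows "eventually (\<lambda>t. (f has_real_derivative deriv f t) (at t)) at_top"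
proof -
  obtain g a where g: "germ_of f = germ_of g"
    "\<And>t. t > a \<Longrightarrow> (g has_real_derivative deriv g t) (at t)"
    using differentiable_germ_cases[OF assms] by metis
  obtain b where b: "\<And>t. t \<ge> b \<Longrightarrow> f t = g t"
    using g(1) by (auto simp: germ_of_eq_iff eventually_at_top_linorder)
  have "(f has_real_derivative deriv f t) (at t)" if "t > max a b" for t
  proof -
    have "(f has_real_derivative deriv g t) (at t)"
      by (rule DERIV_cong_ev[THEN iffD1, OF refl _ refl g(2)])
        (use that in \<open>auto intro!: eventually_mono[OF eventually_nhds_in_open[of "{b<..}"]] simp: b\<close>)
    then show ?thesis by (metis DERIV_imp_deriv)
  qed
  then show ?thesis by (meson eventually_gt_at_top eventually_mono)
qed

lemma differentiable_germ_add:
  assumes "x \<in> differentiable_germs" "y \<in> differentiable_germs"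
  shows "x + y \<in> differentiable_germs" "germ_deriv (x + y) = germ_deriv x + germ_deriv y"
proof -
  obtain f g where [simp]: "x = germ_of f" "y = germ_of g" by (metis germ_cases)
  have "eventually (\<lambda>t. ((\<lambda>t. f t + g t) has_real_derivative deriv f t + deriv g t) (at t)) at_top"
    using assms[simplified, THEN differentiable_germ_of_deriv]
    by eventually_elim (rule DERIV_add)
  from germ_of_has_deriv[OF this]
  show "x + y \<in> differentiable_germs" "germ_deriv (x + y) = germ_deriv x + germ_deriv y"
    by (simp_all add: germ_of_add germ_deriv_of)
qed

lemma differentiable_germ_diff:
  assumes "x \<in> differentiable_germs" "y \<in> differentiable_germs"
  shows "x - y \<in> differentiable_germs" "germ_deriv (x - y) = germ_deriv x - germ_deriv y"
proof -
  obtain f g where [simp]: "x = germ_of f" "y = germ_of g" by (metis germ_cases)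
  have "eventually (\<lambda>t. ((\<lambda>t. f t - g t) has_real_derivative deriv f t - deriv g t) (at t)) at_top"
    using assms[simplified, THEN differentiable_germ_of_deriv]
    by eventually_elim (rule DERIV_diff)
  from germ_of_has_deriv[OF this]
  show "x - y \<in> differentiable_germs" "germ_deriv (x - y) = germ_deriv x - germ_deriv y"
    by (simp_all add: germ_of_diff germ_deriv_of)
qed

lemma differentiable_germ_mult:
  assumes "x \<in> differentiable_germs" "y \<in> differentiable_germs"
  shows "x * y \<in> differentiable_germs" "germ_deriv (x * y) = germ_deriv x * y + x * germ_deriv y"
proof -
  obtain f g where [simp]: "x = germ_of f" "y = germ_of g" by (metis germ_cases)
  have "eventually (\<lambda>t. ((\<lambda>t. f t * g t) has_real_derivative deriv f t * g t + f t * deriv g t) (at t)) at_top"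
    using assms[simplified, THEN differentiable_germ_of_deriv]
    by eventually_elim (rule DERIV_cong[OF DERIV_mult'], assumption+, simp)
  from germ_of_has_deriv[OF this]
  show "x * y \<in> differentiable_germs" "germ_deriv (x * y) = germ_deriv x * y + x * germ_deriv y"
    by (simp_all add: germ_of_add germ_of_mult germ_deriv_of)
qed

lemma differentiable_germ_inv:
  assumes "x \<in> differentiable_germs" "x * germ_inv x = 1"
  shows "germ_inv x \<in> differentiable_germs"
    "germ_deriv (germ_inv x) = - (germ_inv x * germ_deriv x * germ_inv x)"
proof -
  obtain f where [simp]: "x = germ_of f" by (metis germ_cases)
  have "eventually (\<lambda>t. f t \<noteq> 0) at_top"
    using assms(2) unfolding \<open>x = _\<close> germ_of_simps by eventually_elim auto
  with assms(1)[simplified, THEN differentiable_germ_of_deriv]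
  have "eventually (\<lambda>t. ((\<lambda>t. inverse (f t)) has_real_derivative
      - (inverse (f t) * deriv f t * inverse (f t))) (at t)) at_top"
    by eventually_elim (rule DERIV_inverse')
  from germ_of_has_deriv[OF this]
  show "germ_inv x \<in> differentiable_germs"
    "germ_deriv (germ_inv x) = - (germ_inv x * germ_deriv x * germ_inv x)"
    by (simp_all add: germ_of_minus germ_of_mult germ_inv_of germ_deriv_of)
qed

text \<open>A continuous representative without zeros on a ray keeps its sign there, by the
  intermediate value theorem.\<close>

lemma germ_sign:
  assumes "x \<in> differentiable_germs" "x * germ_inv x = 1"
  shows "0 <\<^sub>e x \<or> x <\<^sub>e 0"
proof -
  obtain f a where f: "x = germ_of f" "continuous_on {a..} f"
    using differentiable_germ_cases[OF assms(1)] by metis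
  have "eventually (\<lambda>t. f t \<noteq> 0) at_top"
    using assms(2) unfolding f(1) germ_of_simps by eventually_elim auto
  then obtain b where b: "\<And>t. t \<ge> b \<Longrightarrow> f t \<noteq> 0"
    by (auto simp: eventually_at_top_linorder)
  have conn: "connected (f ` {max a b..})"
    by (intro connected_continuous_image continuous_on_subset[OF f(2)]) auto
  have nz: "0 \<notin> f ` {max a b..}" using b by auto
  have "(\<forall>t\<ge>max a b. f t > 0) \<or> (\<forall>t\<ge>max a b. f t < 0)"
  proof (rule ccontr)
    assume "\<not> ?thesis"
    then obtain s t where "s \<ge> max a b" "t \<ge> max a b" "f s \<le> 0" "f t \<ge> 0" by force
    then have "0 \<in> f ` {max a b..}"
      using connectedD_interval[OF conn, of "f s" "f t" 0] by blast
    with nz show False by blast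
  qed
  then show ?thesis
    unfolding f(1) germ_of_simps eventually_at_top_linorder by blast
qed

subsection \<open>Adjoining an infinitely large germ\<close>

text \<open>The ring \<open>K[y]\<close> of polynomial values in Horner form; induction peels off
  the constant coefficient.\<close>

inductive_set poly_germs :: "germ set \<Rightarrow> germ \<Rightarrow> germ set" for K y where
  zero: "0 \<in> poly_germs K y"
| pCons: "a \<in> K \<Longrightarrow> v \<in> poly_germs K y \<Longrightarrow> a + y * v \<in> poly_germs K y"

text \<open>The field \<open>K(y)\<close> as fractions. It deserves the name where nonzero elements
  of \<open>poly_germs K y\<close> are units, which \<open>infinite_extension\<close>
  ensures.\<close>

definition adjoin :: "germ set \<Rightarrow> germ \<Rightarrow> germ set" where
  "adjoin K y = {v * germ_inv w |v w. v \<in> poly_germs K y \<and> w \<in> poly_germs K y \<and> w \<noteq> 0}"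

lemma poly_germs_const: "a \<in> K \<Longrightarrow> a \<in> poly_germs K y"
  using poly_germs.pCons[OF _ poly_germs.zero, of a K y] by simp

lemma poly_germs_shift: "0 \<in> K \<Longrightarrow> v \<in> poly_germs K y \<Longrightarrow> y * v \<in> poly_germs K y"
  using poly_germs.pCons[of 0 K v y] by simp

lemma poly_germs_mono:
  assumes "K \<subseteq> K'" "v \<in> poly_germs K y"
  shows "v \<in> poly_germs K' y"
  using assms(2) by induction (use assms(1) in \<open>auto intro: poly_germs.intros\<close>)

lemma adjoin_mono: "K \<subseteq> K' \<Longrightarrow> adjoin K y \<subseteq> adjoin K' y"
  unfolding adjoin_def using poly_germs_mono by blast

lemma poly_germs_add:
  assumes K: "is_subfield K" and "v \<in> poly_germs K y" "w \<in> poly_germs K y"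
  shows "v + w \<in> poly_germs K y"
  using assms(2,3)
proof (induction arbitrary: w)
  case zero
  then show ?case by simp
next
  case (pCons a v)
  note A = pCons
  from A(4) show ?case
  proof cases
    case zero
    with A show ?thesis by (auto intro: poly_germs.pCons)
  next
    case (pCons b u)
    have "a + y * v + w = (a + b) + y * (v + u)" unfolding pCons(1) by (simp add: algebra_simps)
    then show ?thesis
      using poly_germs.pCons[OF subfield_add[OF K A(1) pCons(2)] A(3)[OF pCons(3)]] by (simp only:)
  qed
qed

lemma poly_germs_smult:
  assumes K: "is_subfield K" and "v \<in> poly_germs K y" "a \<in> K"
  shows "a * v \<in> poly_germs K y"
  using assms(2)
proof induction
  case (pCons b v)
  have "a * (b + y * v) = a * b + y * (a * v)" by (simp add: algebra_simps)
  then show ?case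
    using pCons assms by (auto intro!: poly_germs.pCons subfield_mult)
qed (simp add: poly_germs.zero)

lemma poly_germs_mult:
  assumes K: "is_subfield K" and "v \<in> poly_germs K y" "w \<in> poly_germs K y"
  shows "v * w \<in> poly_germs K y"
  using assms(2)
proof induction
  case (pCons b v)
  have "(b + y * v) * w = b * w + y * (v * w)" by (simp add: algebra_simps)
  moreover have "b * w + y * (v * w) \<in> poly_germs K y"
    by (rule poly_germs_add[OF K poly_germs_smult[OF K assms(3) pCons(1)]
          poly_germs_shift[OF subfield_zero[OF K] pCons(3)]])
  ultimately show ?case by (simp only:)
qed (simp add: poly_germs.zero)

lemma poly_germs_diff:
  assumes K: "is_subfield K" and "v \<in> poly_germs K y" "w \<in> poly_germs K y"
  shows "v - w \<in> poly_germs K y"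
proof -
  have "v - w = v + (- 1) * w" by simp
  moreover have "v + (- 1) * w \<in> poly_germs K y"
    using assms by (intro poly_germs_add poly_germs_smult subfield_minus subfield_one)
  ultimately show ?thesis by simp
qed

lemma adjoin_minimal:
  assumes S: "is_subfield S" and "K \<subseteq> S" "y \<in> S"
  shows "adjoin K y \<subseteq> S"
proof -
  have "v \<in> S" if "v \<in> poly_germs K y" for v
    using that by induction (use assms in \<open>auto intro: subfield_closed\<close>)
  then show ?thesis
    unfolding adjoin_def using S by (auto intro: subfield_mult subfield_germ_inv)
qed

section \<open>Adjoining a germ that exceeds a whole field\<close>

locale infinite_extension =
  fixes K :: "germ set" and y :: germ
  assumes K: "is_subfield K" and K_diff: "K \<subseteq> differentiable_germs"
    and y_diff: "y \<in> differentiable_germs" and y_greater: "\<And>k. k \<in> K \<Longrightarrow> k <\<^sub>e y"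
begin

lemma two_in: "1 + 1 \<in> K"
  by (intro subfield_add subfield_one K)

text \<open>Induction on the Horner form. If \<open>v = 0\<close>, the value is \<open>a\<close>
  itself, and half of its absolute value serves as \<open>c\<close>. Otherwise the \<open>c\<close>
  of \<open>v\<close> also serves for \<open>a + y * v\<close>, since \<open>y\<close> exceeds
  \<open>(c - a) / c\<close> and \<open>(c + a) / c\<close>, both in \<open>K\<close>.\<close>

lemma poly_germs_bounded_away:
  assumes "v \<in> poly_germs K y"
  shows "v = 0 \<or> (\<exists>c\<in>K. 0 <\<^sub>e c \<and> (c <\<^sub>e v \<or> c <\<^sub>e - v))"
  using assms
proof induction
  case (pCons a v)
  show ?case
  proof (cases "v = 0")
    case True
    show ?thesis
    proof (cases "a = 0")
      case False
      have inv2: "(1 + 1 :: germ) * germ_inv (1 + 1) = 1"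
        by (simp add: germ_of_simps)
      then have h: "germ_inv (1 + 1) \<in> K"
        using subfield_germ_inv(1)[OF K two_in] by fastforce
      obtain f where f: "a = germ_of f" by (metis germ_cases)
      have "0 <\<^sub>e a \<or> a <\<^sub>e 0"
        using germ_sign subfield_germ_inv(2)[OF K pCons(1) False] pCons(1) K_diff by blast
      then show ?thesis
      proof
        assume "0 <\<^sub>e a"
        then have "0 <\<^sub>e a * germ_inv (1 + 1)" "a * germ_inv (1 + 1) <\<^sub>e a"
          unfolding f germ_of_simps by (auto elim: eventually_mono)
        moreover have "a * germ_inv (1 + 1) \<in> K"
          using K pCons(1) h by (rule subfield_mult)
        ultimately show ?thesis using True by auto
      next
        assume "a <\<^sub>e 0"
        then have "0 <\<^sub>e - a * germ_inv (1 + 1)" "- a * germ_inv (1 + 1) <\<^sub>e - a"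
          unfolding f germ_of_simps by (auto elim: eventually_mono)
        moreover have "- a * germ_inv (1 + 1) \<in> K"
          using K h pCons(1) by (intro subfield_mult subfield_minus)
        ultimately show ?thesis using True by auto
      qed
    qed (simp add: True)
  next
    case False
    then obtain c where c: "c \<in> K" "0 <\<^sub>e c" "c <\<^sub>e v \<or> c <\<^sub>e - v" using pCons.IH by blast
    obtain f g h z where r: "a = germ_of f" "v = germ_of g" "c = germ_of h" "y = germ_of z"
      by (metis germ_cases)
    have "c \<noteq> 0" using c(2) germ_less_irrefl by auto
    then have ic: "germ_inv c \<in> K" using K c subfield_germ_inv by blast
    have gr: "(c - a) * germ_inv c <\<^sub>e y" "(c + a) * germ_inv c <\<^sub>e y" "0 <\<^sub>e y"
      using K c pCons(1) ic by (auto intro!: y_greater subfield_closed)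
    have "c <\<^sub>e a + y * v \<or> c <\<^sub>e - (a + y * v)"
      using c(3)
    proof
      assume "c <\<^sub>e v"
      then have "c <\<^sub>e a + y * v"
        using gr c(2) unfolding r germ_of_simps
      proof eventually_elim
        case (elim t)
        then have "h t - f t < z t * h t" by (simp add: field_simps)
        also have "\<dots> \<le> z t * g t" using elim by (intro mult_left_mono) auto
        finally show ?case by simp
      qed
      then show ?thesis ..
    next
      assume "c <\<^sub>e - v"
      then have "c <\<^sub>e - (a + y * v)"
        using gr c(2) unfolding r germ_of_simps
      proof eventually_elim
        case (elim t)
        then have "h t + f t < z t * h t" by (simp add: field_simps)
        also have "\<dots> \<le> z t * - g t" using elim by (intro mult_left_mono) auto
        finally show ?case by simp
      qed
      then show ?thesis ..
    qed
    then show ?thesis using c by blast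
  qed
qed simp

lemma poly_germs_invertible:
  assumes "v \<in> poly_germs K y" "v \<noteq> 0"
  shows "v * germ_inv v = 1"
proof -
  obtain c where c: "0 <\<^sub>e c" "c <\<^sub>e v \<or> c <\<^sub>e - v"
    using poly_germs_bounded_away[OF assms(1)] assms(2) by blast
  obtain f g where [simp]: "v = germ_of f" "c = germ_of g" by (metis germ_cases)
  from c show ?thesis
    unfolding \<open>v = _\<close> \<open>c = _\<close> germ_of_simps by (auto elim: eventually_elim2)
qed

text \<open>Each Horner step raises the exponent by 2: \<open>\<bar>a + y * v\<bar> < y + y ^ (m +
  1) \<le> 2 * y ^ (m + 1) \<le> y ^ (m + 2)\<close>, where \<open>2 < y\<close> because
  \<open>1 + 1\<close> is in \<open>K\<close>.\<close>

lemma poly_germs_bound: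
  assumes "v \<in> poly_germs K y"
  shows "\<exists>m. v <\<^sub>e y ^ m \<and> - v <\<^sub>e y ^ m"
  using assms
proof induction
  case zero
  have "0 <\<^sub>e (1 :: germ)" unfolding germ_of_simps by simp
  then show ?case by (intro exI[of _ 0]) simp
next
  case (pCons a v)
  then obtain m where m: "v <\<^sub>e y ^ m" "- v <\<^sub>e y ^ m" by blast
  obtain f g z where r: "a = germ_of f" "v = germ_of g" "y = germ_of z"
    by (metis germ_cases)
  have gr: "a <\<^sub>e y" "- a <\<^sub>e y" "1 + 1 <\<^sub>e y"
    using K pCons(1) two_in by (auto intro!: y_greater subfield_closed)
  have "eventually (\<lambda>t. \<bar>f t + z t * g t\<bar> < z t ^ (m + 2)) at_top"
    using gr m unfolding r germ_of_simps
  proof eventually_elim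
    case (elim t)
    have "\<bar>f t + z t * g t\<bar> \<le> \<bar>f t\<bar> + z t * \<bar>g t\<bar>"
      using elim by (simp add: abs_mult abs_triangle_ineq[THEN order_trans])
    also have "\<dots> < z t + z t * z t ^ m"
      using elim by (intro add_strict_mono mult_strict_left_mono) auto
    also have "\<dots> \<le> z t ^ (m + 1) + z t ^ (m + 1)"
      using elim by (simp add: mult_le_cancel_left1)
    also have "\<dots> = 2 * z t ^ (m + 1)" by simp
    also have "\<dots> \<le> z t * z t ^ (m + 1)"
      using elim by (intro mult_right_mono) auto
    finally show ?case by (simp add: algebra_simps)
  qed
  then have "a + y * v <\<^sub>e y ^ (m + 2)" "- (a + y * v) <\<^sub>e y ^ (m + 2)"
    unfolding r germ_of_simps by (eventually_elim, auto)+
  then show ?case by blast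
qed

lemma poly_germs_differentiable:
  "v \<in> poly_germs K y \<Longrightarrow> v \<in> differentiable_germs"
proof (induction rule: poly_germs.induct)
  case zero
  then show ?case using K K_diff subfield_zero by blast
next
  case (pCons a v)
  then show ?case
    using K_diff y_diff by (auto intro!: differentiable_germ_add(1) differentiable_germ_mult(1))
qed

text \<open>The numerator is below \<open>y ^ m\<close>; the denominator stays above some positive
  \<open>c\<close> of \<open>K\<close> in absolute value, so its inverse is below
  \<open>germ_inv c\<close>, hence below \<open>y\<close>.\<close>

lemma adjoin_bound:
  assumes "x \<in> adjoin K y"
  shows "\<exists>m. x <\<^sub>e y ^ m"
proof -
  obtain v w where x: "x = v * germ_inv w" "v \<in> poly_germs K y" "w \<in> poly_germs K y" "w \<noteq> 0"
    using assms unfolding adjoin_def by blast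
  obtain m where m: "v <\<^sub>e y ^ m" "- v <\<^sub>e y ^ m" using poly_germs_bound[OF x(2)] by blast
  obtain c where c: "c \<in> K" "0 <\<^sub>e c" "c <\<^sub>e w \<or> c <\<^sub>e - w"
    using poly_germs_bounded_away[OF x(3)] x(4) by blast
  obtain f g h z where r: "v = germ_of f" "w = germ_of g" "c = germ_of h" "y = germ_of z"
    by (metis germ_cases)
  have "c \<noteq> 0" using c(2) germ_less_irrefl by auto
  then have ic: "germ_inv c <\<^sub>e y" using K c subfield_germ_inv y_greater by blast
  have "eventually (\<lambda>t. h t < \<bar>g t\<bar>) at_top"
    using c(3) unfolding r germ_of_simps by (auto elim: eventually_mono)
  then have "x <\<^sub>e y ^ (m + 1)"
    using m c(2) ic unfolding x(1) r germ_of_simps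
  proof eventually_elim
    case (elim t)
    have "f t * inverse (g t) \<le> \<bar>f t\<bar> * inverse \<bar>g t\<bar>"
      by (metis abs_ge_self abs_inverse abs_mult)
    also have "\<dots> \<le> z t ^ m * inverse (h t)"
      using elim by (intro mult_mono le_imp_inverse_le) auto
    also have "\<dots> < z t ^ m * z t"
      using elim by (intro mult_strict_left_mono) auto
    finally show ?case by (simp add: mult.commute)
  qed
  then show ?thesis by blast
qed

lemma adjoin_subset_differentiable: "adjoin K y \<subseteq> differentiable_germs"
proof
  fix x assume "x \<in> adjoin K y"
  then obtain v w where "x = v * germ_inv w" "v \<in> poly_germs K y" "w \<in> poly_germs K y" "w \<noteq> 0"
    unfolding adjoin_def by blast
  then show "x \<in> differentiable_germs"
    using differentiable_germ_mult(1)[OF _ differentiable_germ_inv(1)]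
      poly_germs_differentiable poly_germs_invertible by simp
qed

lemma adjoinI: "v \<in> poly_germs K y \<Longrightarrow> w \<in> poly_germs K y \<Longrightarrow> w \<noteq> 0 \<Longrightarrow> v * germ_inv w \<in> adjoin K y"
  unfolding adjoin_def by blast

lemma germ_inv_one: "germ_inv 1 = 1"
  by (simp add: germ_of_simps)

lemma poly_germs_subset_adjoin: "poly_germs K y \<subseteq> adjoin K y"
proof
  fix v assume "v \<in> poly_germs K y"
  then show "v \<in> adjoin K y"
    using adjoinI[of v 1] K by (auto simp: germ_inv_one intro: poly_germs_const subfield_one)
qed

lemma subset_adjoin: "K \<subseteq> adjoin K y"
  using poly_germs_subset_adjoin poly_germs_const by blast

lemma in_adjoin: "y \<in> adjoin K y"
  using poly_germs_subset_adjoin poly_germs_shift[OF subfield_zero[OF K] poly_germs_const[OF subfield_one[OF K]]]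
  by auto

lemma adjoin_subfield: "is_subfield (adjoin K y)"
proof (rule is_subfield_germI)
  show "1 \<in> adjoin K y" using subset_adjoin K subfield_one by blast
next
  fix a b assume "a \<in> adjoin K y" "b \<in> adjoin K y"
  then obtain v w v' w' where
    a: "a = v * germ_inv w" "v \<in> poly_germs K y" "w \<in> poly_germs K y" "w \<noteq> 0" and
    b: "b = v' * germ_inv w'" "v' \<in> poly_germs K y" "w' \<in> poly_germs K y" "w' \<noteq> 0"
    unfolding adjoin_def by blast
  have i: "w * germ_inv w = 1" "w' * germ_inv w' = 1"
    using a b poly_germs_invertible by auto
  \<comment> \<open>The ring of germs has zero divisors; the product of the two denominators is
    nonzero because both are units.\<close>
  have "w * w' * germ_inv (w * w') = (w * germ_inv w) * (w' * germ_inv w')"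
    by (simp add: germ_inv_mult mult_ac)
  then have "w * w' \<noteq> 0" using i by (metis mult_1 mult_zero_left zero_neq_one)
  then have ad: "u * germ_inv (w * w') \<in> adjoin K y" if "u \<in> poly_germs K y" for u
    using that a b K by (intro adjoinI poly_germs_mult)
  have "(v * w' - v' * w) * germ_inv (w * w')
      = v * germ_inv w * (w' * germ_inv w') - v' * germ_inv w' * (w * germ_inv w)"
    by (simp add: germ_inv_mult algebra_simps)
  then have "a - b = (v * w' - v' * w) * germ_inv (w * w')" using a b i by simp
  then show "a - b \<in> adjoin K y"
    using ad a b K by (auto intro: poly_germs_mult poly_germs_diff)
  have "a * b = (v * v') * germ_inv (w * w')" using a b by (simp add: germ_inv_mult mult_ac)
  then show "a * b \<in> adjoin K y"
    using ad a b K by (auto intro: poly_germs_mult)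
next
  fix a assume "a \<in> adjoin K y" "a \<noteq> 0"
  then obtain v w where
    a: "a = v * germ_inv w" "v \<in> poly_germs K y" "w \<in> poly_germs K y" "w \<noteq> 0"
    unfolding adjoin_def by blast
  have "v \<noteq> 0" using \<open>a \<noteq> 0\<close> a by auto
  have g: "germ_inv a = w * germ_inv v"
    by (simp add: a germ_inv_mult germ_inv_germ_inv mult.commute)
  have "a * germ_inv a = (v * germ_inv v) * (w * germ_inv w)"
    unfolding g by (subst a(1)) (simp add: mult_ac)
  then have "a * germ_inv a = 1"
    using poly_germs_invertible a \<open>v \<noteq> 0\<close> by simp
  moreover have "germ_inv a \<in> adjoin K y"
    unfolding g using a \<open>v \<noteq> 0\<close> by (intro adjoinI)
  ultimately show "germ_inv a \<in> adjoin K y \<and> a * germ_inv a = 1" by blast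
qed

end

subsection \<open>Towers of logarithmic derivatives\<close>

text \<open>The field \<open>H(z n, ..., z (n + k - 1))\<close>, built from its last generator:
  \<open>z (n + k - 1)\<close> is adjoined first and \<open>z n\<close> last, so that in a
  \<open>germ_tower\<close> every generator exceeds the field to which it is adjoined.\<close>

primrec tower :: "germ set \<Rightarrow> (nat \<Rightarrow> germ) \<Rightarrow> nat \<Rightarrow> nat \<Rightarrow> germ set" where
  "tower H z 0 n = H"
| "tower H z (Suc k) n = adjoin (tower H z k (Suc n)) (z n)"

text \<open>Difference, product and quotient rule. Once the generators of a field of differentiable
  germs have their derivatives in it, minimality of the field makes it closed under
  differentiation.\<close>

lemma subfield_deriv_closed:
  assumes G: "is_subfield G" and diff: "G \<subseteq> differentiable_germs"
  shows "is_subfield {x\<in>G. germ_deriv x \<in> G}"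
proof (rule is_subfield_germI)
  have "germ_deriv 1 = 0" unfolding one_germ_of zero_germ_of by (rule germ_of_has_deriv) simp
  then show "1 \<in> {x\<in>G. germ_deriv x \<in> G}" using G by (auto intro: subfield_closed)
next
  fix x assume x: "x \<in> {x\<in>G. germ_deriv x \<in> G}" "x \<noteq> 0"
  then have i: "germ_inv x \<in> G" "x * germ_inv x = 1"
    using G subfield_germ_inv by blast+
  then have "germ_deriv (germ_inv x) = - (germ_inv x * germ_deriv x * germ_inv x)"
    using x diff by (intro differentiable_germ_inv) auto
  with i x show "germ_inv x \<in> {x\<in>G. germ_deriv x \<in> G} \<and> x * germ_inv x = 1"
    using G by (auto intro: subfield_mult subfield_minus)
next
  fix x u assume xu: "x \<in> {x\<in>G. germ_deriv x \<in> G}" "u \<in> {x\<in>G. germ_deriv x \<in> G}"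
  then have d: "x \<in> differentiable_germs" "u \<in> differentiable_germs"
    using diff by auto
  show "x - u \<in> {x\<in>G. germ_deriv x \<in> G}" "x * u \<in> {x\<in>G. germ_deriv x \<in> G}"
    using xu G by (auto simp: differentiable_germ_diff[OF d] differentiable_germ_mult[OF d]
        intro: subfield_closed)
qed

text \<open>A Hardy field \<open>L\<close> around the generators keeps the hull from being an
  intersection over the empty family and hands down differentiability; closure under differentiation
  follows from that of the set of generators.\<close>

lemma generates_hardy_fieldI:
  assumes H: "hardy_field H" and L: "hardy_field L" "H \<subseteq> L" "y \<in> L"
  shows "generates_hardy_field y H"
proof -
  let ?X = "H \<union> range (\<lambda>n. (germ_deriv ^^ n) y)"
  let ?G = "generated_diff_field H y"
  have L': "is_subfield L" "L \<subseteq> differentiable_germs" "\<And>f. f \<in> L \<Longrightarrow> germ_deriv f \<in> L"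
    using L unfolding hardy_field_def by auto
  have "(germ_deriv ^^ n) y \<in> L" for n by (induction n) (auto intro: L L')
  then have "?X \<subseteq> L" using L by auto
  then have "?G \<subseteq> L" unfolding generated_diff_field_def using L' by (intro hull_minimal)
  have XG: "?X \<subseteq> ?G" unfolding generated_diff_field_def by (rule hull_subset)
  have G_iff: "x \<in> ?G \<longleftrightarrow> (\<forall>S. is_subfield S \<and> ?X \<subseteq> S \<longrightarrow> x \<in> S)" for x
    unfolding generated_diff_field_def hull_def by blast
  \<comment> \<open>Subfields intersect in a subfield, since an inverse is unique and so lies in all
    of them.\<close>
  have G: "is_subfield ?G"
  proof (rule is_subfield_germI)
    fix x assume "x \<in> ?G" "x \<noteq> 0"
    then show "germ_inv x \<in> ?G \<and> x * germ_inv x = 1"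
      using \<open>?G \<subseteq> L\<close> L'(1) unfolding G_iff by (metis subfield_germ_inv subsetD G_iff)
  qed (auto simp: G_iff intro: subfield_closed)
  have "is_subfield {x\<in>?G. germ_deriv x \<in> ?G}"
    by (rule subfield_deriv_closed[OF G]) (use \<open>?G \<subseteq> L\<close> L'(2) in blast)
  moreover have "germ_deriv x \<in> ?X" if "x \<in> ?X" for x
    using that
  proof
    assume "x \<in> H" then show ?thesis using H by (auto simp: hardy_field_def)
  next
    assume "x \<in> range (\<lambda>n. (germ_deriv ^^ n) y)"
    then obtain n where "x = (germ_deriv ^^ n) y" by blast
    then have "germ_deriv x = (germ_deriv ^^ Suc n) y" by simp
    then show ?thesis by blast
  qed
  ultimately have "?G \<subseteq> {x\<in>?G. germ_deriv x \<in> ?G}"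
    using XG unfolding generated_diff_field_def[of H y]
    by (intro hull_minimal) (auto simp: generated_diff_field_def[symmetric])
  then show ?thesis
    unfolding generates_hardy_field_def hardy_field_def using G \<open>?G \<subseteq> L\<close> L'(2) by blast
qed


section \<open>The differential field generated by a tower\<close>

locale germ_tower =
  fixes H :: "germ set" and z :: "nat \<Rightarrow> germ"
  assumes H: "hardy_field H"
    and z_diff: "z n \<in> differentiable_germs"
    and z_deriv: "germ_deriv (z n) = z n * z (Suc n)"
    and z_greater: "h \<in> H \<Longrightarrow> h <\<^sub>e z n"
    and z_power: "z (Suc n) ^ m <\<^sub>e z n"
begin

text \<open>Proved together by induction on \<open>k\<close>: adjoining \<open>z n\<close> to
  \<open>tower H z k (Suc n)\<close> takes all three at \<open>k\<close>. Elements of the new fields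
  are then below powers of the last adjoined and fastest generator, and \<open>z_power\<close>
  places the powers of \<open>z (Suc n)\<close> below \<open>z n\<close>.\<close>

lemma tower_subfield: "is_subfield (tower H z k n)" (is "?F k n")
  and tower_differentiable: "tower H z k n \<subseteq> differentiable_germs" (is "?D k n")
  and tower_less: "x \<in> tower H z k (Suc n) \<Longrightarrow> x <\<^sub>e z n"
proof -
  have "(\<forall>n. ?F k n) \<and> (\<forall>n. ?D k n) \<and> (\<forall>n. \<forall>x\<in>tower H z k (Suc n). x <\<^sub>e z n)"
  proof (induction k)
    case 0
    then show ?case using H z_greater by (auto simp: hardy_field_def)
  next
    case (Suc k)
    have ext: "infinite_extension (tower H z k (Suc n)) (z n)" for n
      using Suc z_diff by unfold_locales auto
    have "x <\<^sub>e z n" if x: "x \<in> tower H z (Suc k) (Suc n)" for x n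
    proof -
      obtain m where "x <\<^sub>e z (Suc n) ^ m"
        using infinite_extension.adjoin_bound[OF ext] x by auto
      then show ?thesis using z_power by (rule germ_less_trans)
    qed
    then show ?case
      using infinite_extension.adjoin_subfield[OF ext]
        infinite_extension.adjoin_subset_differentiable[OF ext] by simp
  qed
  then show "?F k n" "?D k n" "x \<in> tower H z k (Suc n) \<Longrightarrow> x <\<^sub>e z n" by auto
qed

lemma infinite_extension_tower: "infinite_extension (tower H z k (Suc n)) (z n)"
  using tower_subfield tower_differentiable z_diff tower_less by unfold_locales auto

text \<open>The additional generator \<open>z (n + k)\<close> is adjoined directly to
  \<open>H\<close>, at the inner end of the construction; hence the induction through
  \<open>adjoin_mono\<close>.\<close>

lemma tower_Suc: "tower H z k n \<subseteq> tower H z (Suc k) n"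
proof (induction k arbitrary: n)
  case 0
  then show ?case using infinite_extension.subset_adjoin[OF infinite_extension_tower[of 0]] by simp
next
  case (Suc k)
  from adjoin_mono[OF Suc[of "Suc n"], of "z n"] show ?case by simp
qed

lemma tower_mono: "k \<le> k' \<Longrightarrow> tower H z k n \<subseteq> tower H z k' n"
  by (rule lift_Suc_mono_le[of "\<lambda>k. tower H z k n"]) (rule tower_Suc)

lemma in_tower: "k > 0 \<Longrightarrow> z (n + j) \<in> tower H z (j + k) n"
proof (induction j arbitrary: n)
  case 0
  then obtain k' where "k = Suc k'" by (cases k) auto
  then show ?case using infinite_extension.in_adjoin[OF infinite_extension_tower] by simp
next
  case (Suc j)
  have "z (Suc n + j) \<in> tower H z (j + k) (Suc n)" using Suc by blast
  then show ?case
    using infinite_extension.subset_adjoin[OF infinite_extension_tower, of "j + k" n] by auto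
qed

text \<open>A directed union of fields. The derivative of \<open>z n\<close> involves
  \<open>z (Suc n)\<close>, hence the union over all \<open>k\<close>. By
  \<open>subfield_deriv_closed\<close>, closure under differentiation is a matter of
  \<open>H\<close> and the \<open>z n\<close> alone.\<close>

lemma hardy_field_tower: "hardy_field (\<Union>k. tower H z k 0)"
proof -
  let ?L = "\<Union>k. tower H z k 0"
  have diff: "?L \<subseteq> differentiable_germs" using tower_differentiable by blast
  have common: "\<exists>k. x \<in> tower H z k 0 \<and> y \<in> tower H z k 0" if xy: "x \<in> ?L" "y \<in> ?L" for x y
  proof -
    obtain i j where "x \<in> tower H z i 0" "y \<in> tower H z j 0" using xy by blast
    then have "x \<in> tower H z (max i j) 0" "y \<in> tower H z (max i j) 0"
      using tower_mono[of i "max i j"] tower_mono[of j "max i j"] by auto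
    then show ?thesis by blast
  qed
  have zL: "z n \<in> ?L" for n using in_tower[of 1 0 n] by (intro UN_I[of "n + 1"]) (simp_all only: add_0 zero_less_one UNIV_I)
  have HL: "H \<subseteq> ?L"
  proof
    fix x assume "x \<in> H"
    then have "x \<in> tower H z 0 0" by simp
    then show "x \<in> ?L" by blast
  qed
  have L: "is_subfield ?L"
  proof (rule is_subfield_germI)
    show "1 \<in> ?L" using subfield_one[OF tower_subfield] by blast
  next
    fix x y assume "x \<in> ?L" "y \<in> ?L"
    then obtain k where k: "x \<in> tower H z k 0" "y \<in> tower H z k 0" using common by blast
    show "x - y \<in> ?L" using subfield_diff[OF tower_subfield k] by blast
    show "x * y \<in> ?L" using subfield_mult[OF tower_subfield k] by blast
  next
    fix x assume "x \<in> ?L" "x \<noteq> 0"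
    then obtain k where k: "x \<in> tower H z k 0" by blast
    show "germ_inv x \<in> ?L \<and> x * germ_inv x = 1"
      using subfield_germ_inv[OF tower_subfield k \<open>x \<noteq> 0\<close>] by blast
  qed
  let ?S = "{x\<in>?L. germ_deriv x \<in> ?L}"
  have S: "is_subfield ?S" using L diff by (rule subfield_deriv_closed)
  have "z n \<in> ?S" for n
    using zL subfield_mult[OF L zL zL, of n "Suc n"] by (auto simp: z_deriv)
  moreover have "H \<subseteq> ?S"
    using HL H unfolding hardy_field_def by (intro subsetI CollectI conjI) blast+
  ultimately have "tower H z k n \<subseteq> ?S" for k n
  proof (induction k arbitrary: n)
    case (Suc k)
    from adjoin_minimal[OF S Suc.IH[OF Suc.prems] Suc.prems(1)] show ?case
      by (simp only: tower.simps)
  qed (simp only: tower.simps)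
  then have "?L \<subseteq> ?S" by blast
  then show ?thesis unfolding hardy_field_def using L diff by blast
qed

lemma generates: "generates_hardy_field (z 0) H"
proof (rule generates_hardy_fieldI[OF H hardy_field_tower])
  show "H \<subseteq> (\<Union>k. tower H z k 0)" using UN_upper[of 0 UNIV "\<lambda>k. tower H z k 0"] by simp
  show "z 0 \<in> (\<Union>k. tower H z k 0)" using in_tower[of 1 0 0] by (intro UN_I[of "0 + 1"]) (simp_all only: add_0 zero_less_one UNIV_I)
qed

end

subsection \<open>Smooth functions\<close>

definition deriv_closed :: "(real \<Rightarrow> real) set \<Rightarrow> bool" where
  "deriv_closed A \<longleftrightarrow> (\<forall>f\<in>A. \<exists>f'\<in>A. \<forall>t. (f has_real_derivative f' t) (at t))"

text \<open>Infinite differentiability on the whole line in coinductive form: a set that contains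
  \<open>f\<close> and is closed under differentiation is a certificate.\<close>

definition smooth :: "(real \<Rightarrow> real) \<Rightarrow> bool" where
  "smooth f \<longleftrightarrow> (\<exists>A. deriv_closed A \<and> f \<in> A)"

inductive_set alg_hull :: "(real \<Rightarrow> real) set \<Rightarrow> (real \<Rightarrow> real) set" for B where
  base: "f \<in> B \<Longrightarrow> f \<in> alg_hull B"
| const: "(\<lambda>t. c) \<in> alg_hull B"
| add: "f \<in> alg_hull B \<Longrightarrow> g \<in> alg_hull B \<Longrightarrow> (\<lambda>t. f t + g t) \<in> alg_hull B"
| mult: "f \<in> alg_hull B \<Longrightarrow> g \<in> alg_hull B \<Longrightarrow> (\<lambda>t. f t * g t) \<in> alg_hull B"

text \<open>By the Leibniz rule only the generators matter, and their derivatives may be polynomials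
  in generators. Proofs of smoothness thus reduce to finding a suitable \<open>B\<close>.\<close>

lemma deriv_closed_alg_hull:
  assumes "\<And>f. f \<in> B \<Longrightarrow> \<exists>f'\<in>alg_hull B. \<forall>t. (f has_real_derivative f' t) (at t)"
  shows "deriv_closed (alg_hull B)"
  unfolding deriv_closed_def
proof
  fix f assume "f \<in> alg_hull B"
  then show "\<exists>f'\<in>alg_hull B. \<forall>t. (f has_real_derivative f' t) (at t)"
  proof induction
    case (const c)
    show ?case by (rule bexI[of _ "\<lambda>t. 0"]) (auto intro: alg_hull.const)
  next
    case (add f g)
    then obtain f' g' where "f' \<in> alg_hull B" "g' \<in> alg_hull B"
      "\<forall>t. (f has_real_derivative f' t) (at t)" "\<forall>t. (g has_real_derivative g' t) (at t)"
      by blast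
    then show ?case
      by (intro bexI[of _ "\<lambda>t. f' t + g' t"]) (auto intro: alg_hull.add DERIV_add)
  next
    case (mult f g)
    then obtain f' g' where "f' \<in> alg_hull B" "g' \<in> alg_hull B"
      "\<forall>t. (f has_real_derivative f' t) (at t)" "\<forall>t. (g has_real_derivative g' t) (at t)"
      by blast
    with mult show ?case
      by (intro bexI[of _ "\<lambda>t. f' t * g t + f t * g' t"])
        (auto intro!: alg_hull.add alg_hull.mult derivative_eq_intros)
  qed (use assms in blast)
qed

lemma smooth_alg_hull:
  assumes "\<And>f. f \<in> B \<Longrightarrow> \<exists>f'\<in>alg_hull B. \<forall>t. (f has_real_derivative f' t) (at t)"
    and "f \<in> alg_hull B"
  shows "smooth f"
  using deriv_closed_alg_hull[OF assms(1)] assms(2) unfolding smooth_def by blast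

lemma smooth_deriv:
  assumes "smooth f"
  obtains f' where "smooth f'" "\<And>t. (f has_real_derivative f' t) (at t)"
  using assms unfolding smooth_def deriv_closed_def by metis

lemma smooth_continuous: "smooth f \<Longrightarrow> continuous_on S f"
  by (metis smooth_deriv DERIV_continuous_on has_field_derivative_at_within)

lemma smooth_closure:
  assumes "f \<in> alg_hull (Collect smooth)"
  shows "smooth f"
  using _ assms
proof (rule smooth_alg_hull)
  fix f assume "f \<in> Collect smooth"
  then show "\<exists>f'\<in>alg_hull (Collect smooth). \<forall>t. (f has_real_derivative f' t) (at t)"
    by (metis alg_hull.base mem_Collect_eq smooth_deriv)
qed

lemma smooth_const: "smooth (\<lambda>t. c)"
  and smooth_add: "smooth f \<Longrightarrow> smooth g \<Longrightarrow> smooth (\<lambda>t. f t + g t)"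
  and smooth_mult: "smooth f \<Longrightarrow> smooth g \<Longrightarrow> smooth (\<lambda>t. f t * g t)"
  by (auto intro!: smooth_closure intro: alg_hull.intros)

lemma smooth_affine:
  assumes "smooth f"
  shows "smooth (\<lambda>t. f (a * t + b))"
proof (rule smooth_alg_hull)
  let ?B = "{\<lambda>t. f (a * t + b) |f. smooth f}"
  show "(\<lambda>t. f (a * t + b)) \<in> alg_hull ?B" using assms by (auto intro: alg_hull.base)
  fix g assume "g \<in> ?B"
  then obtain f where f: "g = (\<lambda>t. f (a * t + b))" "smooth f" by blast
  then obtain f' where f': "smooth f'" "\<And>t. (f has_real_derivative f' t) (at t)"
    by (metis smooth_deriv)
  have "(g has_real_derivative a * f' (a * t + b)) (at t)" for t
    unfolding f(1) by (rule DERIV_chain'[OF _ f'(2), THEN DERIV_cong]) (auto intro!: derivative_eq_intros)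
  moreover have "(\<lambda>t. a * f' (a * t + b)) \<in> alg_hull ?B"
    using f'(1) by (intro alg_hull.mult[OF alg_hull.const] alg_hull.base) blast
  ultimately show "\<exists>f'\<in>alg_hull ?B. \<forall>t. (g has_real_derivative f' t) (at t)"
    by (intro bexI[of _ "\<lambda>t. a * f' (a * t + b)"]) auto
qed

lemma smooth_antideriv:
  assumes "smooth f" "\<And>t. (F has_real_derivative f t) (at t)"
  shows "smooth F"
proof -
  obtain A where "deriv_closed A" "f \<in> A" using assms(1) unfolding smooth_def by blast
  then have "deriv_closed (insert F A)" using assms(2) unfolding deriv_closed_def by blast
  then show ?thesis unfolding smooth_def by blast
qed

lemma smooth_higher_deriv_differentiable:
  assumes "smooth f"
  shows "(deriv ^^ n) f differentiable_on S"
proof -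
  obtain A where A: "deriv_closed A" "f \<in> A" using assms unfolding smooth_def by blast
  have step: "deriv g \<in> A" if g: "g \<in> A" for g
  proof -
    obtain g' where g': "g' \<in> A" "\<forall>t. (g has_real_derivative g' t) (at t)"
      using g A(1) unfolding deriv_closed_def by blast
    then have "deriv g = g'" by (intro ext DERIV_imp_deriv) simp
    with g'(1) show ?thesis by simp
  qed
  have "(deriv ^^ n) f \<in> A" 
  proof (induction n)
    case (Suc n)
    show ?case using step[OF Suc] by simp
  qed (simp add: A(2))
  then show ?thesis
    using A(1) unfolding deriv_closed_def
    by (intro differentiable_at_imp_differentiable_on) (auto simp: real_differentiable_def)
qed

subsection \<open>A smooth step\<close>

text \<open>For \<open>k = 0\<close> the classical flat function \<open>exp (- 1 / t)\<close>; the
  factors \<open>inverse t ^ k\<close> make the family closed under differentiation up to linear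
  combinations.\<close>

definition exp_inv :: "nat \<Rightarrow> real \<Rightarrow> real" where
  "exp_inv k t = (if t > 0 then inverse t ^ k * exp (- inverse t) else 0)"

lemma exp_inv_deriv:
  "(exp_inv k has_real_derivative exp_inv (k + 2) t + - real k * exp_inv (k + 1) t) (at t)"
proof -
  consider "t < 0" | "t > 0" | "t = 0" by linarith
  then show ?thesis
  proof cases
    assume t: "t < 0"
    have "((\<lambda>t. 0) has_real_derivative 0) (at t)" by simp
    moreover have "eventually (\<lambda>s. s \<in> {..<0}) (nhds t)"
      using t by (intro eventually_nhds_in_open) auto
    then have "eventually (\<lambda>s. exp_inv k s = 0) (nhds t)"
      by eventually_elim (auto simp: exp_inv_def)
    ultimately show ?thesis
      using t by (subst DERIV_cong_ev[of _ t _ "\<lambda>t. 0"]) (auto simp: exp_inv_def)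
  next
    assume t: "t > 0"
    have "((\<lambda>t. inverse t ^ k * exp (- inverse t)) has_real_derivative
       exp_inv (k + 2) t + - real k * exp_inv (k + 1) t) (at t)"
      using t by (auto intro!: derivative_eq_intros simp: exp_inv_def)
        (cases k; simp add: field_simps power2_eq_square)
    moreover have "eventually (\<lambda>s. s \<in> {0<..}) (nhds t)"
      using t by (intro eventually_nhds_in_open) auto
    then have "eventually (\<lambda>s. exp_inv k s = inverse s ^ k * exp (- inverse s)) (nhds t)"
      by eventually_elim (auto simp: exp_inv_def)
    ultimately show ?thesis
      using t by (subst DERIV_cong_ev[of _ t _ "\<lambda>s. inverse s ^ k * exp (- inverse s)"]) auto
  next
    assume t: "t = 0"
    \<comment> \<open>With \<open>u = 1 / h\<close> the right-hand difference quotient is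
      \<open>u ^ (k + 1) / exp u\<close>, which tends to 0; on the left the quotient is 0.\<close>
    have "((\<lambda>h. inverse h ^ Suc k * exp (- inverse h)) \<longlongrightarrow> 0) (at_right (0::real))"
      using filterlim_compose[OF tendsto_power_div_exp_0[of "Suc k"] filterlim_inverse_at_top_right]
      by (simp add: exp_minus divide_inverse)
    then have "((\<lambda>h. exp_inv k h / h) \<longlongrightarrow> 0) (at_right 0)"
      by (rule Lim_transform_eventually)
        (auto simp: eventually_at_filter exp_inv_def field_simps)
    moreover have "((\<lambda>h. exp_inv k h / h) \<longlongrightarrow> 0) (at_left 0)"
      by (rule tendsto_eventually) (auto simp: eventually_at_filter exp_inv_def)
    ultimately have "((\<lambda>h. exp_inv k h / h) \<longlongrightarrow> 0) (at 0)"
      by (simp add: filterlim_split_at)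
    then show ?thesis unfolding t DERIV_def by (simp add: exp_inv_def)
  qed
qed

lemma smooth_exp_inv: "smooth (exp_inv k)"
proof (rule smooth_alg_hull)
  show "exp_inv k \<in> alg_hull (range exp_inv)" by (auto intro: alg_hull.base)
  fix f assume "f \<in> range exp_inv"
  then obtain k where "f = exp_inv k" by blast
  then show "\<exists>f'\<in>alg_hull (range exp_inv). \<forall>t. (f has_real_derivative f' t) (at t)"
    using exp_inv_deriv[of k]
    by (intro bexI[of _ "\<lambda>t. exp_inv (k + 2) t + - real k * exp_inv (k + 1) t"]
        alg_hull.add alg_hull.mult[OF alg_hull.const] alg_hull.base) blast+
qed

text \<open>As \<open>f\<close> vanishes up to 0, the lower limit 0 can be moved to some
  \<open>a\<close> left of both 0 and \<open>t\<close>; then \<open>t\<close> is an interior point,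
  and the derivative is two-sided also for \<open>t \<le> 0\<close>.\<close>

lemma integral_has_derivative_of_vanishing:
  fixes f :: "real \<Rightarrow> real"
  assumes f: "continuous_on UNIV f" "\<And>t. t \<le> 0 \<Longrightarrow> f t = 0"
  shows "((\<lambda>t. integral {0..t} f) has_real_derivative f t) (at t)"
proof -
  define a where "a = min t 0 - 1"
  have int: "f integrable_on {u..v}" for u v
    by (intro integrable_continuous_interval continuous_on_subset[OF f(1)]) auto
  have zero: "integral {u..v} f = 0" if "v \<le> 0" for u v
    by (rule integral_unique, rule has_integral_is_0) (use that f(2) in auto)
  have eq: "integral {a..s} f = integral {0..s} f" if "s > a" for s
  proof (cases "s \<ge> 0")
    case True
    then have "integral {a..0} f + integral {0..s} f = integral {a..s} f"
      by (intro Henstock_Kurzweil_Integration.integral_combine int) (auto simp: a_def)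
    then show ?thesis by (simp add: zero)
  qed (simp add: zero)
  have "((\<lambda>s. integral {a..s} f) has_real_derivative f t) (at t within {a..t+1})"
    by (rule integral_has_real_derivative[OF continuous_on_subset[OF f(1)]]) (auto simp: a_def)
  then have "((\<lambda>s. integral {a..s} f) has_real_derivative f t) (at t)"
    by (subst (asm) at_within_interior) (auto simp: a_def)
  moreover have "eventually (\<lambda>s. s \<in> {a<..}) (nhds t)"
    by (intro eventually_nhds_in_open) (auto simp: a_def)
  then have "eventually (\<lambda>s. integral {a..s} f = integral {0..s} f) (nhds t)"
    by eventually_elim (auto simp: eq)
  ultimately show ?thesis
    by (subst (asm) DERIV_cong_ev[OF refl _ refl])
qed

lemma nondecreasing_if_deriv_nonneg:
  fixes f :: "real \<Rightarrow> real"
  assumes "\<And>t. (f has_real_derivative f' t) (at t)" "\<And>t. f' t \<ge> 0"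
  shows "mono f"
  by (metis DERIV_nonneg_imp_nondecreasing assms monoI)

text \<open>The normalised antiderivative of a bump \<open>u\<close> that is positive at 1/2 and
  vanishes outside \<open>(0, 1)\<close>.\<close>

lemma smooth_step:
  obtains X where "smooth X" "mono X" "\<And>t. t \<le> 0 \<Longrightarrow> X t = 0" "\<And>t. t \<ge> 1 \<Longrightarrow> X t = 1"
proof -
  define u where "u t = exp_inv 0 t * exp_inv 0 ((-1) * t + 1)" for t
  have u: "smooth u"
    unfolding u_def by (intro smooth_mult smooth_exp_inv smooth_affine)
  have u0: "u t = 0" if "t \<le> 0 \<or> t \<ge> 1" for t
    using that by (auto simp: u_def exp_inv_def)
  have unn: "u t \<ge> 0" for t by (simp add: u_def exp_inv_def)
  define F where "F t = integral {0..t} u" for t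
  have F: "(F has_real_derivative u t) (at t)" for t
    unfolding F_def by (rule integral_has_derivative_of_vanishing[OF smooth_continuous[OF u]]) (simp add: u0)
  have Fs: "smooth F" using u F by (rule smooth_antideriv)
  have "mono F" by (rule nondecreasing_if_deriv_nonneg[OF F unn])
  have F0: "F t = 0" if "t \<le> 0" for t
    unfolding F_def by (rule integral_unique, rule has_integral_is_0) (use that u0 in auto)
  have F1: "F t = F 1" if "t \<ge> 1" for t
  proof (cases "t = 1")
    case False
    have "(F has_real_derivative 0) (at s)" if "1 < s" for s
      using F[of s] u0[of s] that by simp
    then show ?thesis
      using False that by (intro DERIV_isconst_end smooth_continuous[OF Fs]) auto
  qed simp
  have "F 1 > 0"
  proof (rule ccontr)
    assume "\<not> F 1 > 0"
    then have z: "F t = 0" if "t \<in> {0..1}" for t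
      using monoD[OF \<open>mono F\<close>, of 0 t] monoD[OF \<open>mono F\<close>, of t 1] F0[of 0] that by auto
    have "eventually (\<lambda>s. s \<in> {0<..<1}) (nhds (1/2 :: real))"
      by (intro eventually_nhds_in_open) auto
    then have "eventually (\<lambda>s. F s = 0) (nhds (1/2))"
      by eventually_elim (auto simp: z)
    then have "((\<lambda>t. 0) has_real_derivative u (1/2)) (at (1/2))"
      using F[of "1/2"] by (subst (asm) DERIV_cong_ev[OF refl _ refl])
    then have "u (1/2) = 0" by (rule DERIV_unique[OF _ DERIV_const])
    then show False by (simp add: u_def exp_inv_def)
  qed
  show ?thesis
  proof (rule that)
    show "smooth (\<lambda>t. inverse (F 1) * F t)" by (intro smooth_mult smooth_const Fs)
    show "mono (\<lambda>t. inverse (F 1) * F t)"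
      using \<open>mono F\<close> \<open>F 1 > 0\<close> by (auto simp: mono_def)
    show "inverse (F 1) * F t = 1" if "t \<ge> 1" for t using F1[OF that] \<open>F 1 > 0\<close> by simp
  qed (simp add: F0)
qed

subsection \<open>Smooth solutions of the tower of logarithmic derivatives\<close>

lemma integral_lower_bound:
  fixes f :: "real \<Rightarrow> real"
  assumes "continuous_on UNIV f" "0 \<le> s" "s \<le> t" "\<And>u. s \<le> u \<Longrightarrow> u \<le> t \<Longrightarrow> m \<le> f u"
  shows "integral {0..s} f + m * (t - s) \<le> integral {0..t} f"
proof -
  have int: "f integrable_on {u..v}" for u v
    by (intro integrable_continuous_interval continuous_on_subset[OF assms(1)]) auto
  have "integral {s..t} (\<lambda>_. m) \<le> integral {s..t} f"
    by (intro integral_le int) (use assms in auto)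
  moreover have "integral {0..s} f + integral {s..t} f = integral {0..t} f"
    using assms by (intro Henstock_Kurzweil_Integration.integral_combine int) auto
  ultimately show ?thesis using assms(3) by (simp add: mult.commute)
qed

lemma integral_vanishing:
  fixes f :: "real \<Rightarrow> real"
  assumes "\<And>u. 0 \<le> u \<Longrightarrow> u \<le> t \<Longrightarrow> f u = 0"
  shows "integral {0..t} f = 0"
  by (rule integral_unique, rule has_integral_is_0) (use assms in auto)

text \<open>
  The bound on \<open>b\<close> says that \<open>y = c * exp (\<integral> b)\<close> satisfies \<open>y' \<le> y\<^sup>2 / 2\<close>. Solutions of
  \<open>y' = y\<^sup>2 / 2\<close> blow up in finite time, so \<open>b\<close> can become as large as one likes within a unit of time:
  \<open>b\<close> doubles repeatedly, in times that form a geometric progression.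
\<close>
lemma doubling_steps:
  fixes c s :: real
  assumes c: "c \<ge> 16" and s: "s \<ge> 0"
  shows "\<exists>b. smooth b \<and> mono b \<and> (\<forall>t\<le>s. b t = 0) \<and>
    (\<forall>t\<ge>s + 1 - (1/2) ^ (J + 1). b t = c / 4 * 2 ^ J) \<and>
    (\<forall>t. b t \<le> c / 2 * exp (integral {0..t} b)) \<and>
    2 ^ J \<le> exp (integral {0..s + 1 - (1/2) ^ (J + 1)} b)"
proof -
  obtain X where X: "smooth X" "mono X" "\<And>t. t \<le> 0 \<Longrightarrow> X t = 0" "\<And>t. t \<ge> 1 \<Longrightarrow> X t = 1"
    using smooth_step by blast
  have X01: "0 \<le> X t" "X t \<le> 1" for t
    using monoD[OF X(2), of 0 t] X(3)[of t] X(3)[of 0] monoD[OF X(2), of t 1] X(4)[of t] X(4)[of 1]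
    by (cases "t \<le> 0"; cases "t \<ge> 1"; force)+
  show ?thesis
  proof (induction J)
    case 0
    \<comment> \<open>The first step fits into \<open>[s, s + 1/2]\<close> and stays below
      \<open>c / 2\<close>, which suffices as the exponential is at least 1.\<close>
    define b where "b t = c / 4 * X (2 * t + (- 2 * s))" for t
    have b: "smooth b" unfolding b_def by (intro smooth_mult smooth_const smooth_affine X)
    have b0: "b t \<ge> 0" "b t \<le> c / 4" for t using X01[of "2 * t + (- 2 * s)"] c by (auto simp: b_def)
    have I0: "0 \<le> integral {0..t} b" for t
      by (rule integral_nonneg[OF integrable_continuous_interval[OF smooth_continuous[OF b]]]) (rule b0)
    have "mono b" using monoD[OF X(2)] c by (auto simp: mono_def b_def)
    moreover have "b t \<le> c / 2 * exp (integral {0..t} b)" for t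
    proof -
      have "c / 2 * 1 \<le> c / 2 * exp (integral {0..t} b)"
        using c I0[of t] by (intro mult_left_mono) auto
      then show ?thesis using b0(2)[of t] c by linarith
    qed
    moreover have "b t = 0" if "t \<le> s" for t using that X(3) by (simp add: b_def)
    moreover have "b t = c / 4 * 2 ^ 0" if "t \<ge> s + 1 - (1/2) ^ (0 + 1)" for t
      using that X(4) by (simp add: b_def)
    moreover have "2 ^ 0 \<le> exp (integral {0..s + 1 - (1/2) ^ (0 + 1)} b)" using I0 by simp
    ultimately show ?case using b by blast
  next
    case (Suc J)
    define \<tau> where "\<tau> = s + 1 - (1/2) ^ (J + 1)"
    define \<beta> where "\<beta> = c / 4 * 2 ^ J"
    define \<delta> :: real where "\<delta> = (1/2) ^ (J + 2)"
    obtain b where b: "smooth b" "mono b" "\<And>t. t \<le> s \<Longrightarrow> b t = 0" "\<And>t. t \<ge> \<tau> \<Longrightarrow> b t = \<beta>"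
      "\<And>t. b t \<le> c / 2 * exp (integral {0..t} b)" "2 ^ J \<le> exp (integral {0..\<tau>} b)"
      using Suc unfolding \<tau>_def[symmetric] \<beta>_def[symmetric] by blast
    have pos: "\<beta> > 0" "\<delta> > 0" using c by (auto simp: \<beta>_def \<delta>_def)
    \<comment> \<open>This is where 16 comes from: a height of at least \<open>\<beta>\<close>
      lasting for a time \<open>\<delta>\<close> adds at least 1 to the integral, so the exponential
      grows by a factor of at least \<open>exp 1 \<ge> 2\<close>.\<close>
    have "\<delta> * \<beta> = c / 16" by (simp add: \<beta>_def \<delta>_def power_divide)
    then have db: "\<beta> * \<delta> \<ge> 1" using c by (simp add: mult.commute)
    have half: "(1/2) ^ (J + 1) \<le> (1 :: real)" by (rule power_le_one) auto
    then have \<tau>: "0 \<le> \<tau>" "s \<le> \<tau>" using s by (auto simp: \<tau>_def)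
    have \<tau>': "s + 1 - (1/2) ^ (Suc J + 1) = \<tau> + \<delta>" by (simp add: \<tau>_def \<delta>_def)
    \<comment> \<open>A second step of the same height \<open>\<beta>\<close> on
      \<open>[\<tau>, \<tau> + \<delta>]\<close> doubles \<open>b\<close>. The bound survives, as
      \<open>2 * \<beta> = c / 2 * 2 ^ J\<close> and the exponential is already at least
      \<open>2 ^ J\<close> at \<open>\<tau>\<close>.\<close>
    define d where "d t = \<beta> * X (inverse \<delta> * t + (- inverse \<delta> * \<tau>))" for t
    have X_arg: "inverse \<delta> * t + (- inverse \<delta> * \<tau>) = (t - \<tau>) / \<delta>" for t
      using pos by (simp add: field_simps)
    have d: "smooth d" unfolding d_def by (intro smooth_mult smooth_const smooth_affine X)
    have d01: "0 \<le> d t" "d t \<le> \<beta>" for t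
      using X01[of "inverse \<delta> * t + (- inverse \<delta> * \<tau>)"] pos by (auto simp: d_def)
    have d0: "d t = 0" if "t \<le> \<tau>" for t
      using X(3)[of "(t - \<tau>) / \<delta>"] that pos unfolding d_def X_arg by (simp add: divide_nonpos_pos)
    have d1: "d t = \<beta>" if "t \<ge> \<tau> + \<delta>" for t
      using X(4)[of "(t - \<tau>) / \<delta>"] that pos unfolding d_def X_arg by simp
    have "mono d"
      unfolding d_def X_arg using pos
      by (intro monoI mult_left_mono monoD[OF X(2)]) (auto simp: divide_right_mono)
    define e where "e t = b t + d t" for t
    have e: "smooth e" unfolding e_def by (intro smooth_add b d)
    note cont = smooth_continuous[OF e, of UNIV]
    have eb: "integral {0..t} e = integral {0..t} b" if "t \<le> \<tau>" for t
      by (rule Henstock_Kurzweil_Integration.integral_cong) (use that d0 in \<open>auto simp: e_def\<close>)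
    have grow: "integral {0..\<tau>} b + \<beta> * (t - \<tau>) \<le> integral {0..t} e" if "t \<ge> \<tau>" for t
      using integral_lower_bound[OF cont \<tau>(1) that, of \<beta>] b(4) d01 by (simp add: eb e_def)
    have "e t \<le> c / 2 * exp (integral {0..t} e)" for t
    proof (cases "t \<le> \<tau>")
      case True
      then show ?thesis using b(5)[of t] by (simp add: eb d0 e_def)
    next
      case False
      then have "integral {0..\<tau>} b \<le> integral {0..t} e"
        using grow[of t] pos mult_nonneg_nonneg[of \<beta> "t - \<tau>"] by linarith
      then have "2 ^ J \<le> exp (integral {0..t} e)"
        using b(6) by (meson exp_le_cancel_iff order_trans)
      then have "c / 2 * 2 ^ J \<le> c / 2 * exp (integral {0..t} e)"
        using c by (intro mult_left_mono) auto
      moreover have "e t \<le> c / 2 * 2 ^ J"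
        using False b(4)[of t] d01(2)[of t] by (simp add: e_def \<beta>_def)
      ultimately show ?thesis by linarith
    qed
    moreover have "2 ^ Suc J \<le> exp (integral {0..\<tau> + \<delta>} e)"
    proof -
      have "2 * 2 ^ J \<le> exp 1 * exp (integral {0..\<tau>} b)"
        using b(6) exp_ge_add_one_self[of 1] by (intro mult_mono) auto
      also have "\<dots> = exp (integral {0..\<tau>} b + 1)" by (simp add: exp_add)
      also have "\<dots> \<le> exp (integral {0..\<tau> + \<delta>} e)" using grow[of "\<tau> + \<delta>"] pos db by simp
      finally show ?thesis by simp
    qed
    moreover have "e t = c / 4 * 2 ^ Suc J" if "t \<ge> \<tau> + \<delta>" for t
      using that b(4)[of t] d1[of t] pos by (simp add: e_def \<beta>_def)
    moreover have "e t = 0" if "t \<le> s" for t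
      using that b(3)[of t] d0[of t] \<tau> by (simp add: e_def)
    moreover have "mono e"
      unfolding e_def using b(2) \<open>mono d\<close> by (auto simp: mono_def intro: add_mono)
    ultimately show ?case using e unfolding \<tau>' by blast
  qed
qed

text \<open>The value \<open>C \<ge> 16\<close> lets the construction be repeated with
  \<open>C\<close> in place of \<open>c\<close>; \<open>M\<close> makes it as large as
  desired.\<close>

lemma fast_step:
  fixes c s M :: real
  assumes c: "c \<ge> 16" and s: "s \<ge> 0"
  obtains b C where "C \<ge> 16" "C \<ge> M" "smooth b" "mono b" "\<And>t. t \<le> s \<Longrightarrow> b t = 0"
    "\<And>t. t \<ge> s + 1 \<Longrightarrow> b t = C" "\<And>t. b t \<le> c / 2 * exp (integral {0..t} b)"
proof -
  \<comment> \<open>As \<open>c / 4 \<ge> 4\<close>, the plateau \<open>c / 4 * 2 ^ J\<close> is at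
    least \<open>4 * 2 ^ J\<close>, hence above 16 and \<open>M\<close>.\<close>
  obtain J where J: "max 4 M < 2 ^ J" using real_arch_pow[of 2 "max 4 M"] by auto
  have "4 * 2 ^ J \<le> c / 4 * 2 ^ J" using c by (intro mult_right_mono) auto
  moreover have "4 < (2::real) ^ J" "M < 2 ^ J" using J by auto
  ultimately have C: "c / 4 * 2 ^ J \<ge> 16" "c / 4 * 2 ^ J \<ge> M" by linarith+
  have le: "s + 1 - (1/2) ^ (J + 1) \<le> s + 1" by simp
  obtain b where b: "smooth b" "mono b" "\<forall>t\<le>s. b t = 0"
    "\<forall>t\<ge>s + 1 - (1/2) ^ (J + 1). b t = c / 4 * 2 ^ J"
    "\<forall>t. b t \<le> c / 2 * exp (integral {0..t} b)"
    using doubling_steps[OF c s, of J] by blast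
  show ?thesis
    by (rule that[OF C b(1,2)]) (use b le order_trans in blast)+
qed

section \<open>The infinite tower as a locally finite limit\<close>

locale step_sequence =
  fixes b :: "nat \<Rightarrow> real \<Rightarrow> real" and c :: "nat \<Rightarrow> real"
  assumes smooth_b: "smooth (b n)" and mono_b: "mono (b n)"
    and b_zero: "t \<le> real n \<Longrightarrow> b n t = 0"
    and b_const: "t \<ge> real n + 1 \<Longrightarrow> b n t = c n"
    and c_ge: "c n \<ge> 16"
    and b_bound: "b (Suc n) t \<le> c n / 2 * exp (integral {0..t} (b (Suc n)))"
begin

lemma b_nonneg: "b n t \<ge> 0"
  using monoD[OF mono_b, of "min t (real n)" t n] b_zero[of "min t (real n)" n] by simp

text \<open>The nested exponentials cut off after \<open>k\<close> levels, level
  \<open>n + k\<close> being replaced by 0. Up to time \<open>n + k\<close> this is exact, because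
  \<open>b (n + k)\<close> vanishes until then.\<close>

primrec approx :: "nat \<Rightarrow> nat \<Rightarrow> real \<Rightarrow> real" where
  "approx 0 n t = 0"
| "approx (Suc k) n t = b n t * exp (integral {0..t} (approx k (Suc n)))"

text \<open>Any number of levels \<open>k \<ge> t - n\<close> gives the same value;
  \<open>nat \<lceil>t\<rceil>\<close> serves for all \<open>n\<close> at once.\<close>

definition y :: "nat \<Rightarrow> real \<Rightarrow> real" where
  "y n t = approx (nat \<lceil>t\<rceil>) n t"

lemma approx_zero: "t \<le> real n \<Longrightarrow> approx k n t = 0"
  by (cases k) (auto simp: b_zero)

lemma approx_continuous: "continuous_on UNIV (approx k n)"
proof (induction k arbitrary: n)
  case (Suc k)
  have "((\<lambda>t. integral {0..t} (approx k (Suc n))) has_real_derivative approx k (Suc n) t) (at t)" for t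
    by (rule integral_has_derivative_of_vanishing[OF Suc]) (simp add: approx_zero)
  then have "continuous_on UNIV (\<lambda>t. integral {0..t} (approx k (Suc n)))"
    by (intro DERIV_continuous_on) auto
  moreover have "approx (Suc k) n = (\<lambda>t. b n t * exp (integral {0..t} (approx k (Suc n))))" by auto
  ultimately show ?case
    by (simp only:) (intro continuous_on_mult continuous_on_exp smooth_continuous[OF smooth_b])
qed simp

lemma approx_Suc: "t \<le> real n + real k \<Longrightarrow> approx (Suc k) n t = approx k n t"
proof (induction k arbitrary: n t)
  case 0
  then show ?case by (simp add: b_zero)
next
  case (Suc k)
  have "integral {0..t} (approx (Suc k) (Suc n)) = integral {0..t} (approx k (Suc n))"
    by (rule Henstock_Kurzweil_Integration.integral_cong) (use Suc in auto)
  then show ?case by (simp only: approx.simps(2))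
qed

lemma approx_mono: "t \<le> real n + real k \<Longrightarrow> k \<le> k' \<Longrightarrow> approx k' n t = approx k n t"
proof (induction "k' - k" arbitrary: k')
  case (Suc i)
  then obtain k'' where "k' = Suc k''" by (cases k') auto
  with Suc show ?case by (cases "k' = k") (auto simp: approx_Suc simp del: approx.simps)
qed simp

lemma y_eq_approx:
  assumes "t \<le> real n + real k"
  shows "y n t = approx k n t"
proof -
  have "t \<le> real n + real (nat \<lceil>t\<rceil>)" by linarith
  then show ?thesis
    unfolding y_def using assms approx_mono[of t n k "max k (nat \<lceil>t\<rceil>)"]
      approx_mono[of t n "nat \<lceil>t\<rceil>" "max k (nat \<lceil>t\<rceil>)"] by simp
qed

lemma y_zero: "t \<le> real n \<Longrightarrow> y n t = 0"
  by (simp add: y_def approx_zero)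

lemma y_eq: "y n t = b n t * exp (integral {0..t} (y (Suc n)))"
proof -
  have t: "t \<le> real (nat \<lceil>t\<rceil>)" by linarith
  have "integral {0..t} (y (Suc n)) = integral {0..t} (approx (nat \<lceil>t\<rceil>) (Suc n))"
  proof (rule Henstock_Kurzweil_Integration.integral_cong)
    fix s assume "s \<in> {0..t}"
    then have "s \<le> real (Suc n) + real (nat \<lceil>t\<rceil>)" using t by (simp only: atLeastAtMost_iff of_nat_Suc) linarith
    then show "y (Suc n) s = approx (nat \<lceil>t\<rceil>) (Suc n) s" by (rule y_eq_approx)
  qed
  moreover have "y n t = approx (Suc (nat \<lceil>t\<rceil>)) n t" by (rule y_eq_approx) (use t in auto)
  ultimately show ?thesis by simp
qed

lemma y_continuous: "continuous_on UNIV (y n)"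
proof -
  have "isCont (y n) t" for t
  proof -
    obtain k :: nat where k: "t < real k" using reals_Archimedean2 by blast
    have "eventually (\<lambda>s. s \<in> {..<real k}) (nhds t)"
      using k by (intro eventually_nhds_in_open) auto
    then have "eventually (\<lambda>s. y n s = approx k n s) (nhds t)"
      by eventually_elim (auto intro!: y_eq_approx)
    then show ?thesis
      using approx_continuous[of k n] isCont_cong by (fastforce simp: continuous_on_eq_continuous_at)
  qed
  then show ?thesis by (simp add: continuous_at_imp_continuous_on)
qed

definition E :: "nat \<Rightarrow> real \<Rightarrow> real" where
  "E n t = integral {0..t} (y (Suc n))"

lemma y_eq_E: "y n t = b n t * exp (E n t)"
  unfolding E_def by (rule y_eq)

lemma E_deriv: "(E n has_real_derivative y (Suc n) t) (at t)"
  unfolding E_def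
  by (rule integral_has_derivative_of_vanishing[OF y_continuous]) (simp add: y_zero)

lemma y_nonneg: "y n t \<ge> 0"
  by (simp add: y_eq_E b_nonneg)

lemma E_nonneg: "E n t \<ge> 0"
  unfolding E_def using y_continuous
  by (intro integral_nonneg integrable_continuous_interval) (auto intro: continuous_on_subset y_nonneg)

text \<open>All levels are treated at once: the derivative of \<open>exp (E n)\<close> is
  \<open>exp (E n) * b (Suc n) * exp (E (Suc n))\<close>, so the algebra generated by these
  exponentials and the smooth functions is closed under differentiation.\<close>

lemma smooth_y: "smooth (y n)"
proof (rule smooth_alg_hull)
  let ?B = "range (\<lambda>n t. exp (E n t)) \<union> Collect smooth"
  have y: "(\<lambda>t. b n t * exp (E n t)) \<in> alg_hull ?B" for n
    by (intro alg_hull.mult alg_hull.base) (use smooth_b in auto)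
  then show "y n \<in> alg_hull ?B"
    using y_eq_E[of n] by presburger
  fix f assume "f \<in> ?B"
  then show "\<exists>f'\<in>alg_hull ?B. \<forall>t. (f has_real_derivative f' t) (at t)"
  proof
    assume "f \<in> range (\<lambda>n t. exp (E n t))"
    then obtain n where f: "f = (\<lambda>t. exp (E n t))" by blast
    have "(f has_real_derivative exp (E n t) * (b (Suc n) t * exp (E (Suc n) t))) (at t)" for t
      unfolding f using E_deriv[of n t] by (auto intro!: derivative_eq_intros simp: y_eq_E)
    moreover have "(\<lambda>t. exp (E n t) * (b (Suc n) t * exp (E (Suc n) t))) \<in> alg_hull ?B"
      by (intro alg_hull.mult[OF alg_hull.base y]) auto
    ultimately show ?thesis
      by (intro bexI[of _ "\<lambda>t. exp (E n t) * (b (Suc n) t * exp (E (Suc n) t))"]) auto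
  next
    assume "f \<in> Collect smooth"
    then obtain f' where "smooth f'" "\<And>t. (f has_real_derivative f' t) (at t)"
      using smooth_deriv by blast
    then show ?thesis by (intro bexI[of _ f']) (auto intro: alg_hull.base)
  qed
qed

section \<open>Growth and comparison of consecutive levels\<close>

lemma y_late: "t \<ge> real n + 1 \<Longrightarrow> y n t = c n * exp (E n t)"
  by (simp add: y_eq_E b_const)

lemma y_ge: "t \<ge> real n + 1 \<Longrightarrow> y n t \<ge> c n"
  using c_ge[of n] E_nonneg[of n t] by (simp add: y_late)

lemma y_deriv:
  assumes "t > real n + 1"
  shows "(y n has_real_derivative y n t * y (Suc n) t) (at t)"
proof -
  have "((\<lambda>s. c n * exp (E n s)) has_real_derivative y n t * y (Suc n) t) (at t)"
    using E_deriv[of n t] assms by (auto intro!: derivative_eq_intros simp: y_late)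
  moreover have "eventually (\<lambda>s. s \<in> {real n + 1<..}) (nhds t)"
    using assms by (intro eventually_nhds_in_open) auto
  then have "eventually (\<lambda>s. c n * exp (E n s) = y n s) (nhds t)"
    by eventually_elim (auto simp: y_late)
  ultimately show ?thesis
    by (subst (asm) DERIV_cong_ev[OF refl _ refl])
qed

text \<open>
  While level \<open>n + 1\<close> is being switched on, the bound is the one of \<open>b\<close>. Afterwards it persists,
  since the logarithmic derivative of \<open>y (n + 1) / y n\<close> is \<open>y (n + 2) - y (n + 1)\<close>, which is
  nonpositive by the same bound at the next level.
\<close>
lemma y_half_on_interval:
  "real n + 1 \<le> t \<Longrightarrow> t \<le> real n + 1 + real k \<Longrightarrow> y (Suc n) t \<le> y n t / 2"
proof (induction k arbitrary: n t)
  case 0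
  then have "y (Suc n) t = 0" by (intro y_zero) auto
  then show ?case using y_nonneg[of n t] by simp
next
  case (Suc k)
  \<comment> \<open>While level \<open>n + 2\<close> is still off, \<open>E (Suc n)\<close> is 0 and
    \<open>y (Suc n)\<close> is just \<open>b (Suc n)\<close>, so that the claim is
    \<open>b_bound\<close>.\<close>
  have start: "y (Suc n) t \<le> y n t / 2" if t: "real n + 1 \<le> t" "t \<le> real n + 2" for t
  proof -
    have flat: "E (Suc n) s = 0" if "s \<le> real n + 2" for s
      unfolding E_def by (rule integral_vanishing) (use that y_zero in auto)
    have "E n t = integral {0..t} (b (Suc n))"
      unfolding E_def by (rule Henstock_Kurzweil_Integration.integral_cong)
        (use t flat in \<open>auto simp: y_eq_E[of "Suc n"]\<close>)
    then show ?thesis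
      using t b_bound[of n t] by (simp add: y_late y_eq_E[of "Suc n"] flat)
  qed
  show ?case
  proof (cases "t \<le> real n + 2")
    case False
    define s where "s = real n + 2"
    have st: "s \<le> t" using False by (simp add: s_def)
    \<comment> \<open>The induction hypothesis is applied one level up: its interval begins one unit
      later, so the shorter length \<open>k\<close> still reaches \<open>t\<close>.\<close>
    have "E (Suc n) t - E n t \<le> E (Suc n) s - E n s"
    proof (rule DERIV_nonpos_imp_nonincreasing[OF st])
      fix u assume u: "s \<le> u" "u \<le> t"
      then have "y (Suc (Suc n)) u \<le> y (Suc n) u / 2"
        using Suc.prems by (intro Suc.IH) (auto simp: s_def)
      then have "y (Suc (Suc n)) u - y (Suc n) u \<le> 0" using y_nonneg[of "Suc n" u] by linarith
      then show "\<exists>d. ((\<lambda>u. E (Suc n) u - E n u) has_real_derivative d) (at u) \<and> d \<le> 0"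
        using DERIV_diff[OF E_deriv[of "Suc n" u] E_deriv[of n u]] by blast
    qed
    then have "E (Suc n) t - E (Suc n) s \<le> E n t - E n s" by linarith
    then have le: "exp (E (Suc n) t - E (Suc n) s) \<le> exp (E n t - E n s)" by simp
    have at_t: "y m t = y m s * exp (E m t - E m s)" if "m \<le> Suc n" for m
      using st that by (simp add: y_late s_def exp_diff)
    have "y (Suc n) t \<le> y n s / 2 * exp (E n t - E n s)"
      unfolding at_t[of "Suc n", simplified]
      using le start[of s] y_nonneg by (intro mult_mono) (auto simp: s_def)
    then show ?thesis using at_t[of n] by simp
  qed (use Suc start in simp)
qed

lemma y_half:
  assumes "real n + 1 \<le> t"
  shows "y (Suc n) t \<le> y n t / 2"
  by (rule y_half_on_interval[OF assms, of "nat \<lceil>t\<rceil>"]) linarith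

lemma y_0_ge: "t \<ge> real k + 1 \<Longrightarrow> y 0 t \<ge> y k t"
proof (induction k)
  case (Suc k)
  then show ?case using y_half[of k t] y_nonneg[of k t] by simp
qed simp

end

lemma smooth_log_tower:
  fixes M :: "nat \<Rightarrow> real"
  obtains y :: "nat \<Rightarrow> real \<Rightarrow> real" where "smooth (y 0)"
    "\<And>n t. t > real n + 1 \<Longrightarrow> (y n has_real_derivative y n t * y (Suc n) t) (at t)"
    "\<And>n t. t \<ge> real n + 1 \<Longrightarrow> y n t \<ge> 16"
    "\<And>n t. t \<ge> real n + 1 \<Longrightarrow> y (Suc n) t \<le> y n t / 2"
    "\<And>n t. t \<ge> real n + 1 \<Longrightarrow> y 0 t \<ge> M n"
proof -
  \<comment> \<open>For pairs \<open>(b n, c n)\<close>, \<open>P\<close> collects the conditions on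
    one level and \<open>Q\<close> is the bound that ties \<open>b (Suc n)\<close> to
    \<open>c n\<close>; hence the dependent choice.\<close>
  define P where "P n p \<longleftrightarrow> snd p \<ge> 16 \<and> snd p \<ge> M n \<and> smooth (fst p) \<and> mono (fst p) \<and>
     (\<forall>t\<le>real n. fst p t = 0) \<and> (\<forall>t\<ge>real n + 1. fst p t = snd p)" for n and p :: "(real \<Rightarrow> real) \<times> real"
  define Q where "Q p q \<longleftrightarrow> (\<forall>t. fst q t \<le> snd p / 2 * exp (integral {0..t} (fst q)))"
    for p q :: "(real \<Rightarrow> real) \<times> real"
  have step: "\<exists>q. P n q \<and> Q p q" if p: "snd p \<ge> 16" for n p
  proof -
    obtain b C where "C \<ge> 16" "C \<ge> M n" "smooth b" "mono b" "\<And>t. t \<le> real n \<Longrightarrow> b t = 0"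
      "\<And>t. t \<ge> real n + 1 \<Longrightarrow> b t = C" "\<And>t. b t \<le> snd p / 2 * exp (integral {0..t} b)"
      using fast_step[OF p, of "real n" "M n"] by (metis of_nat_0_le_iff)
    then show ?thesis by (intro exI[of _ "(b, C)"]) (simp add: P_def Q_def)
  qed
  have "\<exists>f. \<forall>n. P n (f n) \<and> Q (f n) (f (Suc n))"
  proof (rule dependent_nat_choice)
    \<comment> \<open>A dummy predecessor with second component 16 starts the sequence.\<close>
    show "\<exists>p. P 0 p" using step[of "(\<lambda>_. 0, 16)" 0] by auto
    show "\<exists>q. P (Suc n) q \<and> Q p q" if "P n p" for p n
      using step[of p "Suc n"] that by (simp add: P_def)
  qed
  then obtain f where f: "\<And>n. P n (f n)" "\<And>n. Q (f n) (f (Suc n))" by blast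
  interpret step_sequence "\<lambda>n. fst (f n)" "\<lambda>n. snd (f n)"
    by unfold_locales (use f in \<open>auto simp: P_def Q_def\<close>)
  show ?thesis
  proof (rule that[of y])
    show "y n t \<ge> 16" if "t \<ge> real n + 1" for n t
      using y_ge[OF that] c_ge[of n] by linarith
    show "y 0 t \<ge> M n" if "t \<ge> real n + 1" for n t
      using y_ge[OF that] y_0_ge[OF that] f(1)[of n] by (simp add: P_def)
  qed (use smooth_y y_deriv y_half in auto)
qed

subsection \<open>Growth\<close>

text \<open>\<open>F\<close> and \<open>G\<close> are the logarithmic derivatives of
  \<open>f\<close> and \<open>g\<close>. The gap makes \<open>ln f - m * ln g - t\<close>
  nondecreasing, so \<open>f / g ^ m\<close> grows at least like a constant times
  \<open>exp t\<close>.\<close>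

lemma eventually_power_less:
  fixes f g F G :: "real \<Rightarrow> real"
  assumes f: "\<And>t. t \<ge> a \<Longrightarrow> (f has_real_derivative f t * F t) (at t)" "\<And>t. t \<ge> a \<Longrightarrow> f t > 0"
    and g: "\<And>t. t \<ge> a \<Longrightarrow> (g has_real_derivative g t * G t) (at t)" "\<And>t. t \<ge> a \<Longrightarrow> g t > 0"
    and gap: "\<And>t. t \<ge> a \<Longrightarrow> 1 \<le> F t - real m * G t" and K: "K > 0"
  shows "eventually (\<lambda>t. K * g t ^ m < f t) at_top"
proof -
  define D where "D t = ln (f t) - real m * ln (g t) - t" for t
  have D: "D a \<le> D t" if "t \<ge> a" for t
  proof (rule DERIV_nonneg_imp_nondecreasing[OF that])
    fix s assume s: "a \<le> s" "s \<le> t"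
    have "(D has_real_derivative F s - real m * G s - 1) (at s)"
      unfolding D_def using f[OF s(1)] g[OF s(1)] by (auto intro!: derivative_eq_intros)
    then show "\<exists>d. (D has_real_derivative d) (at s) \<and> 0 \<le> d" using gap[OF s(1)] by auto
  qed
  have "K * g t ^ m < f t" if t: "t > max a (ln K - D a)" for t
  proof -
    have pos: "f t > 0" "g t > 0" using t f(2) g(2) by auto
    have "ln (K * g t ^ m) = ln K + real m * ln (g t)"
      using pos K by (simp add: ln_mult ln_realpow)
    also have "\<dots> < ln (f t)" using D[of t] t unfolding D_def by linarith
    finally show ?thesis using pos K by (simp add: ln_less_cancel_iff)
  qed
  then show ?thesis by (meson eventually_gt_at_top eventually_mono)
qed

text \<open>\<open>g\<close> differs from the identity by a real constant, which lies in
  \<open>H\<close>.\<close>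

lemma identity_germ_in:
  assumes H: "hardy_field H" "\<real> \<subseteq> H" and g: "g \<in> H" "germ_deriv g = 1"
  shows "germ_of (\<lambda>t. t) \<in> H"
proof -
  obtain k where k: "g = germ_of k" by (metis germ_cases)
  have "g \<in> differentiable_germs" using g H by (auto simp: hardy_field_def)
  then have "eventually (\<lambda>t. (k has_real_derivative deriv k t) (at t)) at_top"
    unfolding k by (rule differentiable_germ_of_deriv)
  moreover have "eventually (\<lambda>t. deriv k t = 1) at_top"
    using g(2) by (simp add: k germ_deriv_of one_germ_of germ_of_eq_iff)
  ultimately have "eventually (\<lambda>t. (k has_real_derivative 1) (at t)) at_top"
    by eventually_elim simp
  then obtain a where a: "\<And>t. t \<ge> a \<Longrightarrow> (k has_real_derivative 1) (at t)"
    by (auto simp: eventually_at_top_linorder)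
  have "k t - t = k a - a" if "t > a" for t
  proof (rule DERIV_isconst_end[OF that])
    have "((\<lambda>t. k t - t) has_real_derivative 0) (at s)" if "s \<ge> a" for s
      using DERIV_diff[OF a[OF that] DERIV_ident] by simp
    then show "continuous_on {a..t} (\<lambda>t. k t - t)"
      "\<And>s. a < s \<Longrightarrow> s < t \<Longrightarrow> ((\<lambda>t. k t - t) has_real_derivative 0) (at s)"
      by (auto intro!: continuous_at_imp_continuous_on DERIV_isCont)
  qed
  then have "eventually (\<lambda>t. t = k t - (k a - a)) at_top"
    by (intro eventually_mono[OF eventually_gt_at_top[of a]]) (simp add: algebra_simps)
  then have "germ_of (\<lambda>t. t) = g - of_real (k a - a)"
    unfolding k of_real_germ germ_of_diff germ_of_eq_iff .
  moreover have "of_real (k a - a) \<in> H" using H(2) by auto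
  ultimately show ?thesis
    using subfield_diff[of H] H(1) g(1) by (simp add: hardy_field_def)
qed

text \<open>
  As \<open>Y\<close> is nondecreasing, \<open>ln y t \<le> ln y a + t * Y t\<close>, where \<open>ln y\<close> exceeds all of \<open>H\<close>.
\<close>
lemma log_deriv_greater:
  fixes y Y :: "real \<Rightarrow> real"
  assumes H: "hardy_field H" "\<real> \<subseteq> H" "germ_of (\<lambda>t. t) \<in> H" "\<And>h. h \<in> H \<Longrightarrow> germ_exp h \<in> H"
    and y: "\<And>t. t \<ge> a \<Longrightarrow> (y has_real_derivative y t * Y t) (at t)" "\<And>t. t \<ge> a \<Longrightarrow> y t > 0"
    and Y: "\<And>s t. a \<le> s \<Longrightarrow> s \<le> t \<Longrightarrow> Y s \<le> Y t" "\<And>t. t \<ge> a \<Longrightarrow> 0 \<le> Y t"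
    and a: "a \<ge> 0" and y_greater: "\<And>h. h \<in> H \<Longrightarrow> h <\<^sub>e germ_of y" and h: "h \<in> H"
  shows "h <\<^sub>e germ_of Y"
proof -
  obtain u where u: "h = germ_of u" by (metis germ_cases)
  have K: "is_subfield H" using H(1) by (simp add: hardy_field_def)
  have "of_real (ln (y a)) \<in> H" using H(2) by auto
  then have "germ_exp (germ_of (\<lambda>t. t) * h + of_real (ln (y a))) \<in> H"
    using K H(3) h by (intro H(4) subfield_add subfield_mult)
  from y_greater[OF this] have "eventually (\<lambda>t. exp (t * u t + ln (y a)) < y t) at_top"
    by (simp only: u of_real_germ germ_of_mult germ_of_add germ_exp_of germ_of_less_iff)
  moreover have "eventually (\<lambda>t. t > a) at_top" by (rule eventually_gt_at_top)
  ultimately have "eventually (\<lambda>t. u t < Y t) at_top"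
  proof eventually_elim
    case (elim t)
    have at: "a \<le> t" using elim by simp
    \<comment> \<open>Here \<open>t\<close> is fixed and only \<open>s\<close> varies; the
      derivative in \<open>s\<close> is \<open>Y s - Y t \<le> 0\<close>.\<close>
    have "ln (y t) - t * Y t \<le> ln (y a) - a * Y t"
    proof (rule DERIV_nonpos_imp_nonincreasing[OF at, of "\<lambda>s. ln (y s) - s * Y t"])
      fix s assume s: "a \<le> s" "s \<le> t"
      have "((\<lambda>s. ln (y s) - s * Y t) has_real_derivative Y s - Y t) (at s)"
        using y(1,2)[OF s(1)] by (auto intro!: derivative_eq_intros)
      then show "\<exists>d. ((\<lambda>s. ln (y s) - s * Y t) has_real_derivative d) (at s) \<and> d \<le> 0"
        using Y(1)[OF s] by (intro exI[of _ "Y s - Y t"]) simp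
    qed
    moreover have "t * u t + ln (y a) < ln (y t)"
      using elim(1) y(2)[OF at] by (metis exp_less_cancel_iff exp_ln)
    moreover have "0 \<le> a * Y t" using a Y(2)[OF at] by simp
    ultimately have "t * u t < t * Y t" by linarith
    then show ?case using elim a by simp
  qed
  then show ?thesis unfolding u germ_of_less_iff .
qed

theorem theorem5p1:
  fixes H :: "germ set" and \<phi> :: germ
  assumes "hardy_field H" and "\<real> \<subseteq> H" and "liouville_closed H"
    and "\<phi> \<in> continuous_germs" and "\<forall>h\<in>H. h <\<^sub>e \<phi>"
  shows "\<exists>y\<in>smooth_germs. \<phi> <\<^sub>e y \<and> generates_hardy_field y H"
proof -
  obtain f a where f: "\<phi> = germ_of f" "continuous_on {a..} f"
    using assms(4) unfolding continuous_germs_def by blast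
  \<comment> \<open>The intervals \<open>[n + 1, n + 2]\<close> cover the ray from 1 on.
    \<open>M n\<close> will bound \<open>f\<close> on such an interval, and \<open>y 0\<close> is at
    least \<open>M n\<close> from its left end on.\<close>
  have "\<forall>n. \<exists>B. \<forall>t\<in>{max a (real n + 1)..real n + 2}. f t < B"
  proof
    fix n
    have "compact (f ` {max a (real n + 1)..real n + 2})"
      by (intro compact_continuous_image continuous_on_subset[OF f(2)]) auto
    then obtain B where "\<forall>x\<in>f ` {max a (real n + 1)..real n + 2}. norm x \<le> B"
      using compact_imp_bounded bounded_iff by metis
    then have "f t < B + 1" if "t \<in> {max a (real n + 1)..real n + 2}" for t
      using that by (force simp: abs_le_iff)
    then show "\<exists>B. \<forall>t\<in>{max a (real n + 1)..real n + 2}. f t < B" by blast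
  qed
  from choice[OF this] obtain M where
    M: "\<And>n t. t \<in> {max a (real n + 1)..real n + 2} \<Longrightarrow> f t < M n"
    by blast
  obtain y :: "nat \<Rightarrow> real \<Rightarrow> real" where y: "smooth (y 0)"
    "\<And>n t. t > real n + 1 \<Longrightarrow> (y n has_real_derivative y n t * y (Suc n) t) (at t)"
    "\<And>n t. t \<ge> real n + 1 \<Longrightarrow> y n t \<ge> 16"
    "\<And>n t. t \<ge> real n + 1 \<Longrightarrow> y (Suc n) t \<le> y n t / 2"
    "\<And>n t. t \<ge> real n + 1 \<Longrightarrow> y 0 t \<ge> M n"
    using smooth_log_tower[of M] by blast
  have "f t < y 0 t" if "t \<ge> max a 1" for t
  proof -
    define n where "n = nat \<lfloor>t\<rfloor> - 1"
    have n: "real n + 1 \<le> t" "t \<le> real n + 2" using that unfolding n_def by linarith+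
    then show ?thesis using M[of t n] y(5)[of n t] that by simp
  qed
  then have greater: "\<phi> <\<^sub>e germ_of (y 0)"
    unfolding f germ_of_less_iff by (meson eventually_ge_at_top eventually_mono)
  have exp: "\<And>h. h \<in> H \<Longrightarrow> germ_exp h \<in> H"
    and "\<exists>g\<in>H. germ_deriv g = 1"
    using assms(1,3) by (auto simp: liouville_closed_def hardy_field_def subfield_one)
  then have id: "germ_of (\<lambda>t. t) \<in> H" using identity_germ_in assms(1,2) by blast
  have y_greater: "h <\<^sub>e germ_of (y n)" if "h \<in> H" for h n
    using that
  proof (induction n arbitrary: h)
    case 0
    then show ?case using assms(5) greater germ_less_trans by blast
  next
    case (Suc n)
    \<comment> \<open>From \<open>n + 3\<close> on, levels \<open>n\<close> to \<open>n + 2\<close>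
      are all at least 16, and the differential equations of levels \<open>n\<close> and
      \<open>n + 1\<close> hold.\<close>
    show ?case
    proof (rule log_deriv_greater[OF assms(1,2) id exp, of "real n + 3" "y n"])
      show "(y n has_real_derivative y n t * y (Suc n) t) (at t)" if "t \<ge> real n + 3" for t
        using that by (intro y(2)) simp
      show "y n t > 0" "0 \<le> y (Suc n) t" if "t \<ge> real n + 3" for t
        using that y(3)[of n t] y(3)[of "Suc n" t] by auto
      show "y (Suc n) s \<le> y (Suc n) t" if st: "real n + 3 \<le> s" "s \<le> t" for s t
      proof (rule DERIV_nonneg_imp_nondecreasing[OF st(2)])
        fix r assume r: "s \<le> r" "r \<le> t"
        have "0 \<le> y (Suc n) r * y (Suc (Suc n)) r"
          using st r y(3)[of "Suc n" r] y(3)[of "Suc (Suc n)" r] by simp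
        then show "\<exists>d. (y (Suc n) has_real_derivative d) (at r) \<and> 0 \<le> d"
          using st r y(2)[of "Suc n" r] by auto
      qed
    qed (use Suc in auto)
  qed
  \<comment> \<open>The case of exponent 1: the gap is
    \<open>y (Suc n) - y (Suc (Suc n)) \<ge> y (Suc n) / 2 \<ge> 8\<close>.\<close>
  have linear: "eventually (\<lambda>t. K * y (Suc n) t < y n t) at_top" if "K > 0" for K n
  proof -
    have "eventually (\<lambda>t. K * y (Suc n) t ^ 1 < y n t) at_top"
    proof (rule eventually_power_less[OF _ _ _ _ _ that, of "real n + 3" "y n" "y (Suc n)" _ "y (Suc (Suc n))"])
      fix t assume t: "t \<ge> real n + 3"
      show "(y n has_real_derivative y n t * y (Suc n) t) (at t)"
        "(y (Suc n) has_real_derivative y (Suc n) t * y (Suc (Suc n)) t) (at t)"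
        using t by (auto intro!: y(2))
      show "y n t > 0" "y (Suc n) t > 0" using t y(3)[of n t] y(3)[of "Suc n" t] by auto
      show "1 \<le> y (Suc n) t - real 1 * y (Suc (Suc n)) t"
        using t y(3)[of "Suc n" t] y(4)[of "Suc n" t] by simp
    qed
    then show ?thesis by simp
  qed
  \<comment> \<open>Bootstrapping: \<open>linear\<close> one level up with the factor
    \<open>m + 1\<close> gives the gap
    \<open>y (Suc n) - m * y (Suc (Suc n)) > y (Suc (Suc n)) \<ge> 16\<close> for the exponent
    \<open>m\<close>.\<close>
  have power: "eventually (\<lambda>t. y (Suc n) t ^ m < y n t) at_top" for n m
  proof -
    obtain b where b: "\<And>t. t \<ge> b \<Longrightarrow> (real m + 1) * y (Suc (Suc n)) t < y (Suc n) t"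
      using linear[of "real m + 1" "Suc n"] by (auto simp: eventually_at_top_linorder)
    have "eventually (\<lambda>t. 1 * y (Suc n) t ^ m < y n t) at_top"
    proof (rule eventually_power_less[of "max b (real n + 3)" "y n" "y (Suc n)" _ "y (Suc (Suc n))"])
      fix t assume "t \<ge> max b (real n + 3)"
      then have t: "t \<ge> b" "t \<ge> real n + 3" by auto
      show "(y n has_real_derivative y n t * y (Suc n) t) (at t)"
        "(y (Suc n) has_real_derivative y (Suc n) t * y (Suc (Suc n)) t) (at t)"
        using t by (auto intro!: y(2))
      show "y n t > 0" "y (Suc n) t > 0" using t y(3)[of n t] y(3)[of "Suc n" t] by auto
      show "1 \<le> y (Suc n) t - real m * y (Suc (Suc n)) t"
        using b[OF t(1)] t y(3)[of "Suc (Suc n)" t] by (simp add: distrib_right)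
    qed simp
    then show ?thesis by simp
  qed
  interpret germ_tower H "\<lambda>n. germ_of (y n)"
  proof
    fix n m
    have "eventually (\<lambda>t. (y n has_real_derivative y n t * y (Suc n) t) (at t)) at_top"
      using y(2)[of n] by (intro eventually_mono[OF eventually_gt_at_top[of "real n + 1"]])
    from germ_of_has_deriv[OF this]
    show "germ_of (y n) \<in> differentiable_germs"
      "germ_deriv (germ_of (y n)) = germ_of (y n) * germ_of (y (Suc n))"
      by (simp_all add: germ_of_mult)
    show "germ_of (y (Suc n)) ^ m <\<^sub>e germ_of (y n)"
      using power by (simp add: germ_of_power germ_of_less_iff)
  qed (use assms(1) y_greater in auto)
  have "germ_of (y 0) \<in> smooth_germs"
    unfolding smooth_germs_def using smooth_higher_deriv_differentiable[OF y(1)] by blast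
  with greater generates show ?thesis by blast
qed

end
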